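(* For almost all permutation graphs $Q$ of length $k$, $$\mathrm{gex}(Q,n)=2^{O\left(k^{2/3}(\log k)^{7/3}/(\log\log k)^{1/3}\right)}\,n.$$ That is, there is an absolute constant $C>0$ such that the proportion of permutation graphs $Q$ of length $k$ (among all $k!$ of them) satisfying $$\mathrm{gex}(Q,n)\le 2^{C\,k^{2/3}(\log k)^{7/3}/(\log\log k)^{1/3}}\,n\quad\text{for all } n\in\mathbb{Z}^+$$ tends to $1$ as $k\to\infty$.
   Context: Write $[n]=\{1,\dots,n\}$. A graph here means an ordered graph: a linearly ordered vertex set $V$ together with a set $E$ of $2$-element subsets of $V$. A graph $A=(V_1,E_1)$ contains a graph $B=(V_2,E_2)$ if there are an increasing injection $f:V_2\to V_1$ and an injection $g:E_2\to E_1$ with $f(e)\subseteq g(e)$ for every $e\in E_2$; otherwise $A$ avoids $B$. $\mathrm{gex}(Q,n)$ is the maximum number of edges in a graph with $n$ vertices that avoids $Q$. A permutation graph of length $k$ is the graph associated with a $k\times k$ permutation matrix; that is, for some permutation $\pi$ of $[k]$, it is the ordered graph with vertex set $[2k]$ and edge set $\{\{i,k+\pi(i)\}: i\in[k]\}$. There are $k!$ permutation graphs of length $k$, one for each $\pi$. *)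

theory Defs
  imports Complex_Main "HOL-Combinatorics.Permutations"
begin

text \<open>
  An ordered graph is a pair of a vertex set and an edge set; the linear order on the vertices
  is the one of the ambient type.
\<close>

type_synonym 'a graph = "'a set \<times> 'a set set"

definition ordered_graph :: "'a::linorder graph \<Rightarrow> bool" where
  "ordered_graph G \<longleftrightarrow> (\<forall>e\<in>snd G. e \<subseteq> fst G \<and> card e = 2)"

definition contains_graph :: "'a::linorder graph \<Rightarrow> 'b::linorder graph \<Rightarrow> bool" where
  "contains_graph A B \<longleftrightarrow>
     (\<exists>f g. strict_mono_on (fst B) f \<and> f ` fst B \<subseteq> fst A \<and>
            inj_on g (snd B) \<and> g ` snd B \<subseteq> snd A \<and>
            (\<forall>e\<in>snd B. f ` e \<subseteq> g e))"

abbreviation avoids :: "'a::linorder graph \<Rightarrow> 'b::linorder graph \<Rightarrow> bool" where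
  "avoids A B \<equiv> \<not> contains_graph A B"

text \<open>
  Host graphs range over all finite sets of naturals as vertex sets; every finite linear order
  is represented there. The maximum is over a finite set, and this set is nonempty whenever
  \<open>Q\<close> has an edge (see \<open>gex_set_finite\<close> and \<open>gex_set_nonempty\<close> below).
\<close>

definition gex :: "'b::linorder graph \<Rightarrow> nat \<Rightarrow> nat" where
  "gex Q n = Max {card (snd G) | G :: nat graph.
     ordered_graph G \<and> finite (fst G) \<and> card (fst G) = n \<and> avoids G Q}"

definition permutation_graph :: "nat \<Rightarrow> (nat \<Rightarrow> nat) \<Rightarrow> nat graph" where
  "permutation_graph k \<pi> = ({1..2 * k}, {{i, k + \<pi> i} | i. i \<in> {1..k}})"

definition permutation_graphs :: "nat \<Rightarrow> nat graph set" where
  "permutation_graphs k = {permutation_graph k \<pi> | \<pi>. \<pi> permutes {1..k}}"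

lemma gex_set_finite:
  "finite {card (snd G) | G :: nat graph.
     ordered_graph G \<and> finite (fst G) \<and> card (fst G) = n \<and> avoids G Q}"
proof (rule finite_subset[of _ "{..2 ^ n}"])
  have "card (snd G) \<le> 2 ^ n"
    if "ordered_graph G" "finite (fst G)" "card (fst G) = n" for G :: "nat graph"
  proof -
    have "snd G \<subseteq> Pow (fst G)" using that(1) by (auto simp: ordered_graph_def)
    then have "card (snd G) \<le> card (Pow (fst G))" using that(2) by (intro card_mono) auto
    then show ?thesis using that by (simp add: card_Pow)
  qed
  then show "{card (snd G) | G :: nat graph.
     ordered_graph G \<and> finite (fst G) \<and> card (fst G) = n \<and> avoids G Q} \<subseteq> {..2 ^ n}"
    by auto
qed simp

lemma gex_set_nonempty:
  assumes "snd Q \<noteq> {}"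
  shows "{card (snd G) | G :: nat graph.
     ordered_graph G \<and> finite (fst G) \<and> card (fst G) = n \<and> avoids G Q} \<noteq> {}"
proof -
  have "ordered_graph ({..<n}, {})" "avoids ({..<n}, {}) Q"
    using assms by (auto simp: ordered_graph_def contains_graph_def)
  then have "card (snd ({..<n}, {} :: nat set set)) \<in> {card (snd G) | G :: nat graph.
     ordered_graph G \<and> finite (fst G) \<and> card (fst G) = n \<and> avoids G Q}"
    by (intro CollectI exI[of _ "({..<n}, {})"]) simp
  then show ?thesis by blast
qed

lemma permutation_graph_wf:
  assumes "\<pi> permutes {1..k}"
  shows "ordered_graph (permutation_graph k \<pi>)"
proof -
  have "{i, k + \<pi> i} \<subseteq> {1..2 * k} \<and> card {i, k + \<pi> i} = 2" if "i \<in> {1..k}" for i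
  proof -
    have "\<pi> i \<in> {1..k}" using permutes_in_image[OF assms] that by blast
    then show ?thesis using that by auto
  qed
  then show ?thesis by (auto simp: ordered_graph_def permutation_graph_def)
qed

lemma card_permutation_graphs: "card (permutation_graphs k) = fact k"
proof -
  have "inj_on (permutation_graph k) {\<pi>. \<pi> permutes {1..k}}"
  proof (rule inj_onI, rule ext)
    fix \<pi> \<sigma> :: "nat \<Rightarrow> nat" and i
    assume p: "\<pi> \<in> {\<pi>. \<pi> permutes {1..k}}" "\<sigma> \<in> {\<pi>. \<pi> permutes {1..k}}"
      and eq: "permutation_graph k \<pi> = permutation_graph k \<sigma>"
    show "\<pi> i = \<sigma> i"
    proof (cases "i \<in> {1..k}")
      case True
      then have "{i, k + \<pi> i} \<in> snd (permutation_graph k \<sigma>)"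
        unfolding eq[symmetric] by (auto simp: permutation_graph_def)
      then obtain j where j: "j \<in> {1..k}" "{i, k + \<pi> i} = {j, k + \<sigma> j}"
        by (auto simp: permutation_graph_def)
      have "\<pi> i \<in> {1..k}" "\<sigma> j \<in> {1..k}"
        using p True j permutes_in_image by (metis mem_Collect_eq)+
      then show ?thesis using True j by (auto simp: doubleton_eq_iff)
    next
      case False
      then show ?thesis using p by (auto simp: permutes_def)
    qed
  qed
  moreover have "permutation_graphs k = permutation_graph k ` {\<pi>. \<pi> permutes {1..k}}"
    by (auto simp: permutation_graphs_def)
  ultimately show ?thesis by (simp add: card_image card_permutations[OF refl])
qed

end

theory Submission
  imports Defs "HOL-Library.FuncSet" "HOL-Library.Infinite_Set" "HOL-Real_Asymp.Real_Asymp"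
begin

text \<open>
  Adding to the permutation matrix of \<open>\<pi>\<close> one entry in a corner turns the graph problem into
  bounding the number of ones of a matrix that avoids the extended permutation, and the
  recursion of Marcus and Tardos reduces this to showing that \<open>L ^ D\<close> rows, each with \<open>s\<close> ones
  among \<open>s\<^sup>2\<close> columns, contain the pattern.

  View the rows as the leaves of an \<open>L\<close>-ary tree of depth \<open>D\<close> and pick a uniformly random one,
  in row \<open>x\<close> and column \<open>c\<close>. Given \<open>c\<close>, the entropy of \<open>x\<close> is close to its maximum, so that on
  average only \<open>L * ln s\<close> of the about \<open>D * L\<close> subtrees hanging off the path to \<open>x\<close> miss the
  column \<open>c\<close>. These subtrees are disjoint intervals of rows; contracting them and
  deleting the worst rows and columns gives a matrix with at most \<open>2 * L * ln s\<close> zeros in every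
  row and column.

  A random permutation has a bounded number of points in every \<open>p \<times> p\<close> window for
  \<open>p = k powr (7/16)\<close>. Such a permutation can be placed off the zeros: shift its blocks of
  \<open>p\<close> columns independently at random; an exponential moment bound leaves, for every
  block of \<open>p\<close> rows, a shift that avoids all zeros. With \<open>L = k powr (3/8)\<close> the
  resulting exponent \<open>D * log 2 L\<close> has order \<open>k powr (5/8) * log 2 k\<close>, which is below \<open>k powr (2/3)\<close>.
\<close>

subsection \<open>Placing a scattered permutation off sparse zeros\<close>

text \<open>Windows at every position count, not only the aligned blocks used in the placement, so
  that the notion survives the index shift of \<open>corner_extension\<close>.\<close>

definition scattered :: "nat \<Rightarrow> nat \<Rightarrow> nat \<Rightarrow> (nat \<Rightarrow> nat) \<Rightarrow> bool" where
  "scattered p r k \<pi> \<longleftrightarrow> (\<forall>a b. card {i. i < k \<and> i \<in> {a..<a+p} \<and> \<pi> i \<in> {b..<b+p}} \<le> r)"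

text \<open>Each block of \<open>p\<close> indices gets a slot of \<open>2 * p\<close> positions, so
  a shift \<open>V\<close> below \<open>p\<close> keeps it inside its slot.\<close>

definition spread :: "nat \<Rightarrow> (nat \<Rightarrow> nat) \<Rightarrow> nat \<Rightarrow> nat" where
  "spread p V a = 2 * p * (a div p) + V (a div p) + a mod p"

lemma spread_strict_mono:
  fixes p B k :: nat
  assumes "p > 0" "k \<le> B * p" "\<And>s. s < B \<Longrightarrow> V s < p"
  shows "strict_mono_on {..<k} (spread p V)"
proof (rule strict_mono_onI)
  fix a b assume ab: "a \<in> {..<k}" "b \<in> {..<k}" "a < b"
  have aB: "a div p < B" using ab assms by (intro less_mult_imp_div_less) auto
  show "spread p V a < spread p V b"
  proof (cases "a div p = b div p")
    case True
    then have "a mod p < b mod p"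
      using ab(3) by (metis div_mult_mod_eq nat_add_left_cancel_less)
    then show ?thesis using True by (simp add: spread_def)
  next
    case False
    then have "a div p + 1 \<le> b div p" using ab(3) div_le_mono[of a b p] by linarith
    then have "2 * p * (a div p + 1) \<le> 2 * p * (b div p)" by (rule mult_le_mono2)
    moreover have "V (a div p) < p" "a mod p < p" using assms aB by auto
    ultimately show ?thesis unfolding spread_def distrib_left by linarith
  qed
qed

lemma spread_less:
  fixes p B k :: nat
  assumes "p > 0" "k \<le> B * p" "\<And>s. s < B \<Longrightarrow> V s < p" "a < k"
  shows "spread p V a < 2 * p * B"
proof -
  have aB: "a div p < B" using assms by (intro less_mult_imp_div_less) auto
  then have "2 * p * (a div p + 1) \<le> 2 * p * B" by (intro mult_le_mono2) simp
  moreover have "V (a div p) < p" "a mod p < p" using assms aB by auto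
  ultimately show ?thesis unfolding spread_def distrib_left by linarith
qed

lemma exp_le_one_plus_double:
  fixes x :: real assumes "0 \<le> x" "x \<le> 1" shows "exp x \<le> 1 + 2 * x"
proof -
  have "exp x \<le> 1 + x + x\<^sup>2" using assms by (rule exp_bound)
  also have "x\<^sup>2 \<le> x" using assms by (simp add: power2_eq_square mult_left_le)
  finally show ?thesis by simp
qed

lemma block_sum_lessThan:
  fixes h :: "nat \<Rightarrow> 'a::comm_monoid_add"
  shows "(\<Sum>i<B. \<Sum>x\<in>{m*i..<m*i+m}. h x) = (\<Sum>x<m*B. h x)"
proof (induction B)
  case (Suc B)
  have "{..<m * Suc B} = {..<m*B} \<union> {m*B..<m*B+m}" by auto
  then show ?case using Suc by (simp add: sum.union_disjoint[symmetric] ivl_disj_int)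
qed simp

lemma exists_below_average:
  fixes f :: "'a \<Rightarrow> real"
  assumes "finite A" "A \<noteq> {}" "sum f A \<le> real (card A) * c"
  shows "\<exists>x\<in>A. f x \<le> c"
proof (rule ccontr)
  assume "\<not> ?thesis"
  then have "(\<Sum>x\<in>A. c) < sum f A" using assms by (intro sum_strict_mono) auto
  then show False using assms by simp
qed

text \<open>
  Choosing all \<open>U i\<close> independently and uniformly, the sum of \<open>exp ((\<Sum>i<B. F s i (U i)) / M)\<close>
  over \<open>s\<close> has expectation at most \<open>B * exp 4\<close>.
\<close>

lemma exists_small_column_loads:
  fixes F :: "nat \<Rightarrow> nat \<Rightarrow> nat \<Rightarrow> nat" and M :: real and p B :: nat
  assumes p: "p > 0" and B: "B > 0" and M: "M > 0"
    and F1: "\<And>s i u. s < B \<Longrightarrow> i < B \<Longrightarrow> u < p \<Longrightarrow> real (F s i u) \<le> M"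
    and F2: "\<And>s. s < B \<Longrightarrow> (\<Sum>i<B. \<Sum>u<p. real (F s i u)) \<le> 2 * p * M"
    and T: "ln B + 4 < p / M"
  shows "\<exists>U. (\<forall>i<B. U i < p) \<and> (\<forall>s<B. (\<Sum>i<B. F s i (U i)) < p)"
proof -
  define \<Omega> where "\<Omega> = PiE {..<B} (\<lambda>_. {..<p})"
  define Y where "Y s U = (\<Sum>i<B. real (F s i (U i)) / M)" for s U
  have fin: "finite \<Omega>" unfolding \<Omega>_def by (intro finite_PiE) auto
  have card: "card \<Omega> = p ^ B" unfolding \<Omega>_def by (simp add: card_PiE)
  have ne: "\<Omega> \<noteq> {}" using card p by auto
  have one: "(\<Sum>U\<in>\<Omega>. exp (Y s U)) \<le> p ^ B * exp 4" if s: "s < B" for s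
  proof -
    define w where "w i = (\<Sum>u<p. real (F s i u))" for i
    have "(\<Sum>U\<in>\<Omega>. exp (Y s U)) = (\<Sum>U\<in>\<Omega>. \<Prod>i<B. exp (real (F s i (U i)) / M))"
      unfolding Y_def by (simp add: exp_sum)
    also have "\<dots> = (\<Prod>i<B. \<Sum>u<p. exp (real (F s i u) / M))"
      unfolding \<Omega>_def by (rule prod_sum_PiE[symmetric]) auto
    also have "\<dots> \<le> (\<Prod>i<B. p * exp (2 * w i / (p * M)))"
    proof (intro prod_mono conjI)
      fix i assume i: "i \<in> {..<B}"
      \<comment> \<open>\<open>F1\<close> puts the exponents into the unit interval, where
        \<open>exp\<close> has a linear bound; then only the totals \<open>w i\<close> matter, and
        \<open>F2\<close> caps their sum.\<close>
      have "(\<Sum>u<p. exp (real (F s i u) / M)) \<le> (\<Sum>u<p. 1 + 2 * (real (F s i u) / M))"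
        using F1 s i M by (intro sum_mono exp_le_one_plus_double) auto
      also have "\<dots> = p * (1 + 2 * w i / (p * M))"
        using p M unfolding w_def
        by (simp add: sum.distrib distrib_left flip: sum_distrib_left sum_divide_distrib)
      also have "\<dots> \<le> p * exp (2 * w i / (p * M))"
        by (intro mult_left_mono exp_ge_add_one_self) auto
      finally show "(\<Sum>u<p. exp (real (F s i u) / M)) \<le> p * exp (2 * w i / (p * M))" .
    qed (auto intro: sum_nonneg)
    also have "\<dots> = p ^ B * exp (\<Sum>i<B. 2 * w i / (p * M))"
      by (simp add: prod.distrib exp_sum)
    also have "(\<Sum>i<B. 2 * w i / (p * M)) = 2 * (\<Sum>i<B. w i) / (p * M)"
      by (simp add: sum_distrib_left sum_divide_distrib)
    also have "\<dots> \<le> 2 * (2 * p * M) / (p * M)"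
      using F2[OF s] p M unfolding w_def by (intro divide_right_mono mult_left_mono) auto
    also have "\<dots> = 4" using p M by simp
    finally show ?thesis by (simp add: mult_left_mono)
  qed
  have "(\<Sum>U\<in>\<Omega>. \<Sum>s<B. exp (Y s U)) = (\<Sum>s<B. \<Sum>U\<in>\<Omega>. exp (Y s U))"
    by (rule sum.swap)
  also have "\<dots> \<le> (\<Sum>s<B. p ^ B * exp 4)" using one by (intro sum_mono) auto
  finally have "(\<Sum>U\<in>\<Omega>. \<Sum>s<B. exp (Y s U)) \<le> card \<Omega> * (B * exp 4)"
    using card by (simp add: algebra_simps)
  then obtain U where U: "U \<in> \<Omega>" "(\<Sum>s<B. exp (Y s U)) \<le> B * exp 4"
    using exists_below_average[OF fin ne] by blast
  have "(\<Sum>i<B. F s i (U i)) < p" if s: "s < B" for s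
  proof -
    \<comment> \<open>One positive term is at most the whole sum; after taking logarithms,
      \<open>T\<close> gives a load below \<open>p\<close> for every \<open>s\<close> at
      once.\<close>
    have "exp (Y s U) \<le> (\<Sum>s<B. exp (Y s U))" using s by (intro member_le_sum) auto
    also have "\<dots> \<le> exp (ln B + 4)" using U(2) B by (simp add: exp_add)
    finally have "Y s U < p / M" using T by simp
    moreover have "Y s U = real (\<Sum>i<B. F s i (U i)) / M"
      unfolding Y_def by (simp add: sum_divide_distrib)
    ultimately have "real (\<Sum>i<B. F s i (U i)) < p" using M by (simp add: divide_less_cancel)
    then show ?thesis by linarith
  qed
  then show ?thesis using U(1) unfolding \<Omega>_def by (intro exI[of _ U]) auto
qed

text \<open>Rows and columns are cut into blocks of \<open>p\<close>, each with its own shift. The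
  column shifts \<open>U\<close> come first: \<open>F s i u\<close> counts, with multiplicity, the
  shifts of row block \<open>s\<close> spoilt by its points in column block \<open>i\<close> when
  the latter is shifted by \<open>u\<close>. Once the total load of \<open>s\<close> is below
  \<open>p\<close>, some row shift is left.\<close>

lemma scattered_avoids_sparse_zeros:
  fixes y :: real and p B k r :: nat
  assumes p: "p > 0" and kB: "k \<le> B * p" and B: "B > 0" and r: "r > 0" and y: "y > 0"
    and sc: "scattered p r k \<pi>" and \<pi>: "\<And>i. i < k \<Longrightarrow> \<pi> i < k"
    and rows: "\<And>a. a < 2*p*B \<Longrightarrow> card {b. b < 2*p*B \<and> Z a b} \<le> y"
    and cols: "\<And>b. b < 2*p*B \<Longrightarrow> card {a. a < 2*p*B \<and> Z a b} \<le> y"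
    and T: "ln B + 4 < p / (r * y)"
  shows "\<exists>f g. strict_mono_on {..<k} f \<and> strict_mono_on {..<k} g \<and>
    f ` {..<k} \<subseteq> {..<2*p*B} \<and> g ` {..<k} \<subseteq> {..<2*p*B} \<and> (\<forall>i<k. \<not> Z (f i) (g (\<pi> i)))"
proof -
  define bl where "bl s i = {a. a < k \<and> a div p = s \<and> \<pi> a div p = i}" for s i
  define hit where "hit s i u a = {v. v < p \<and> Z (2*p*s + v + a mod p) (2*p*i + u + \<pi> a mod p)}"
    for s i u a
  define F where "F s i u = (\<Sum>a\<in>bl s i. card (hit s i u a))" for s i u
  have inB: "a div p < B" if "a < k" for a
    using that kB by (intro less_mult_imp_div_less) auto
  have finbl: "finite (bl s i)" for s i unfolding bl_def by auto
  have finhit: "finite (hit s i u a)" for s i u a unfolding hit_def by auto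
  have cbl: "card (bl s i) \<le> r" for s i
  proof -
    have "bl s i \<subseteq> {a. a < k \<and> a \<in> {p*s..<p*s+p} \<and> \<pi> a \<in> {p*i..<p*i+p}}"
    proof
      fix a assume "a \<in> bl s i"
      then have "a < k" "a div p = s" "\<pi> a div p = i" by (auto simp: bl_def)
      then show "a \<in> {a. a < k \<and> a \<in> {p*s..<p*s+p} \<and> \<pi> a \<in> {p*i..<p*i+p}}"
        using dividend_less_times_div[OF p, of a] dividend_less_times_div[OF p, of "\<pi> a"]
        by (auto simp: add.commute)
    qed
    then have "card (bl s i) \<le> card {a. a < k \<and> a \<in> {p*s..<p*s+p} \<and> \<pi> a \<in> {p*i..<p*i+p}}"
      by (intro card_mono) auto
    also have "\<dots> \<le> r" using sc unfolding scattered_def by blast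
    finally show ?thesis .
  qed
  have below: "2*p*s + v + c < 2*p*B" if "s < B" "v < p" "c < p" for s v c
  proof -
    have "2*p*(s+1) \<le> 2*p*B" using that by (intro mult_le_mono2) auto
    then show ?thesis using that by (simp add: algebra_simps)
  qed
  \<comment> \<open>The block holds at most \<open>r\<close> points, and for one point the spoilt
    shifts are zeros of a single column.\<close>
  have F1: "real (F s i u) \<le> r * y" if "s < B" "i < B" "u < p" for s i u
  proof -
    have "real (card (hit s i u a)) \<le> y" if a: "a \<in> bl s i" for a
    proof -
      let ?b = "2*p*i + u + \<pi> a mod p"
      have "card (hit s i u a) \<le> card {x. x < 2*p*B \<and> Z x ?b}"
        using \<open>s < B\<close> p below
        by (intro card_inj_on_le[of "\<lambda>v. 2*p*s + v + a mod p"]) (auto simp: hit_def inj_on_def)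
      moreover have "real (card {x. x < 2*p*B \<and> Z x ?b}) \<le> y"
        using below \<open>i < B\<close> \<open>u < p\<close> p by (intro cols) auto
      ultimately show ?thesis by linarith
    qed
    then have "(\<Sum>a\<in>bl s i. real (card (hit s i u a))) \<le> (\<Sum>a\<in>bl s i. y)" by (intro sum_mono)
    also have "\<dots> \<le> r * y" using cbl[of s i] y by simp
    finally show ?thesis by (simp add: F_def)
  qed
  \<comment> \<open>For one point, distinct pairs of shifts reach distinct zeros of the square
    \<open>rect i\<close>; the squares with the same \<open>s\<close> tile a strip of
    \<open>2 * p\<close> rows, each with at most \<open>y\<close> zeros.\<close>
  have F2: "(\<Sum>i<B. \<Sum>u<p. real (F s i u)) \<le> 2 * p * (r * y)" if s: "s < B" for s
  proof -
    define rect where "rect i = (SIGMA x:{2*p*s..<2*p*s+2*p}. {b\<in>{2*p*i..<2*p*i+2*p}. Z x b})" for i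
    have finr: "finite (rect i)" for i unfolding rect_def by auto
    have "(\<Sum>u<p. F s i u) \<le> r * card (rect i)" for i
    proof -
      have "(\<Sum>u<p. F s i u) = (\<Sum>a\<in>bl s i. \<Sum>u<p. card (hit s i u a))"
        unfolding F_def by (rule sum.swap)
      also have "\<dots> \<le> (\<Sum>a\<in>bl s i. card (rect i))"
      proof (intro sum_mono)
        fix a
        have "(\<Sum>u<p. card (hit s i u a)) = card (SIGMA u:{..<p}. hit s i u a)"
          using finhit by (simp add: card_SigmaI)
        also have "\<dots> \<le> card (rect i)"
        proof (rule card_inj_on_le)
          show "inj_on (\<lambda>(u,v). (2*p*s + v + a mod p, 2*p*i + u + \<pi> a mod p))
              (SIGMA u:{..<p}. hit s i u a)" by (auto simp: inj_on_def)
          have "v + c mod p < 2 * p" if "v < p" for v c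
            using mod_less_divisor[OF p, of c] that by linarith
          then show "(\<lambda>(u,v). (2*p*s + v + a mod p, 2*p*i + u + \<pi> a mod p)) `
              (SIGMA u:{..<p}. hit s i u a) \<subseteq> rect i"
            by (auto simp: rect_def hit_def)
        qed (rule finr)
        finally show "(\<Sum>u<p. card (hit s i u a)) \<le> card (rect i)" .
      qed
      also have "\<dots> \<le> r * card (rect i)" using cbl by simp
      finally show ?thesis .
    qed
    then have "(\<Sum>i<B. \<Sum>u<p. F s i u) \<le> (\<Sum>i<B. r * card (rect i))" by (intro sum_mono)
    also have "\<dots> = r * (\<Sum>i<B. \<Sum>x\<in>{2*p*s..<2*p*s+2*p}. card {b\<in>{2*p*i..<2*p*i+2*p}. Z x b})"
      unfolding rect_def by (simp add: sum_distrib_left card_SigmaI)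
    also have "\<dots> = r * (\<Sum>x\<in>{2*p*s..<2*p*s+2*p}. \<Sum>i<B. card {b\<in>{2*p*i..<2*p*i+2*p}. Z x b})"
      by (subst sum.swap) (rule refl)
    also have "\<dots> = r * (\<Sum>x\<in>{2*p*s..<2*p*s+2*p}. card {b. b < 2*p*B \<and> Z x b})"
    proof -
      have "(\<Sum>i<B. card {b\<in>{2*p*i..<2*p*i+2*p}. Z x b}) = card {b. b < 2*p*B \<and> Z x b}" for x
      proof -
        have "(\<Sum>i<B. card {b\<in>{2*p*i..<2*p*i+2*p}. Z x b})
            = (\<Sum>i<B. \<Sum>b\<in>{2*p*i..<2*p*i+2*p}. of_bool (Z x b))"
          by (simp add: Int_def)
        also have "\<dots> = (\<Sum>b<2*p*B. of_bool (Z x b))" by (rule block_sum_lessThan)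
        finally show ?thesis by (simp add: Int_def)
      qed
      then show ?thesis by simp
    qed
    finally have "(\<Sum>i<B. \<Sum>u<p. real (F s i u))
        \<le> r * (\<Sum>x\<in>{2*p*s..<2*p*s+2*p}. real (card {b. b < 2*p*B \<and> Z x b}))"
      by (simp flip: of_nat_sum of_nat_mult)
    also have "\<dots> \<le> r * (\<Sum>x\<in>{2*p*s..<2*p*s+2*p}. y)"
    proof (intro mult_left_mono sum_mono rows)
      fix x assume "x \<in> {2*p*s..<2*p*s+2*p}"
      moreover have "2*p*(s+1) \<le> 2*p*B" using s by (intro mult_le_mono2) auto
      ultimately show "x < 2*p*B" by (simp add: algebra_simps)
    qed auto
    also have "\<dots> = 2 * p * (r * y)" by simp
    finally show ?thesis .
  qed
  obtain U where U: "\<forall>i<B. U i < p" "\<forall>s<B. (\<Sum>i<B. F s i (U i)) < p"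
    using exists_small_column_loads[of p B "r * y" F] p B r y F1 F2 T by auto
  have "\<exists>v<p. \<forall>i<B. \<forall>a\<in>bl s i. v \<notin> hit s i (U i) a" if s: "s < B" for s
  proof -
    let ?bad = "\<Union>i<B. \<Union>a\<in>bl s i. hit s i (U i) a"
    have "card ?bad \<le> (\<Sum>i<B. card (\<Union>a\<in>bl s i. hit s i (U i) a))" by (rule card_UN_le) auto
    also have "\<dots> \<le> (\<Sum>i<B. F s i (U i))"
      unfolding F_def by (intro sum_mono card_UN_le finbl)
    also have "\<dots> < card {..<p}" using U(2) s by simp
    finally have "\<not> {..<p} \<subseteq> ?bad" using finbl finhit
      by (metis (no_types, lifting) card_mono finite_UN finite_lessThan not_less)
    then show ?thesis by blast
  qed
  then have "\<forall>s. \<exists>v. s < B \<longrightarrow> v < p \<and> (\<forall>i<B. \<forall>a\<in>bl s i. v \<notin> hit s i (U i) a)" by blast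
  then obtain V where V: "\<And>s. s < B \<Longrightarrow> V s < p"
    "\<And>s i a. s < B \<Longrightarrow> i < B \<Longrightarrow> a \<in> bl s i \<Longrightarrow> V s \<notin> hit s i (U i) a"
    by metis
  have "\<not> Z (spread p V i) (spread p U (\<pi> i))" if "i < k" for i
    using V(2)[of "i div p" "\<pi> i div p" i] V(1) inB \<pi> that
    by (auto simp: spread_def hit_def bl_def)
  moreover have "spread p V ` {..<k} \<subseteq> {..<2*p*B}" "spread p U ` {..<k} \<subseteq> {..<2*p*B}"
    using spread_less[OF p kB] V(1) U(1) by auto
  moreover have "strict_mono_on {..<k} (spread p V)" "strict_mono_on {..<k} (spread p U)"
    using spread_strict_mono[OF p kB] V(1) U(1) by auto
  ultimately show ?thesis by blast
qed

subsection \<open>Entropy along a path of a tree\<close>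

text \<open>
  The leaf \<open>x\<close> of the \<open>L\<close>-ary tree has the ancestor \<open>x div L ^ d\<close> at height \<open>d\<close>. A pair \<open>(d, e)\<close>
  stands for the subtree with leaves \<open>{x'. x' div L ^ d = e}\<close>; those with
  \<open>e div L = x div L ^ Suc d\<close> hang off the path from the root to \<open>x\<close> (or lie on it).
\<close>

definition empty_cells :: "nat \<Rightarrow> nat \<Rightarrow> nat set \<Rightarrow> nat \<Rightarrow> (nat \<times> nat) set" where
  "empty_cells L D U x =
     {(d, e). d < D \<and> e div L = x div L ^ Suc d \<and> (\<forall>x'\<in>U. x' div L ^ d \<noteq> e)}"

lemma children_eq: "L > 0 \<Longrightarrow> {e. e div L = a} = {a * L..<a * L + L}" for L a :: nat
  by (auto simp: div_nat_eqI algebra_simps dividend_less_times_div)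

lemma finite_empty_cells:
  assumes "L > 0" shows "finite (empty_cells L D U x)"
proof (rule finite_subset)
  show "empty_cells L D U x \<subseteq> (SIGMA d:{..<D}. {e. e div L = x div L ^ Suc d})"
    by (auto simp: empty_cells_def)
  show "finite (SIGMA d:{..<D}. {e. e div L = x div L ^ Suc d})"
    using assms by (simp add: children_eq)
qed

text \<open>This is \<open>ln z \<le> z - 1\<close> at \<open>z = w / u\<close>, scaled by
  \<open>u\<close>; for \<open>u = 0\<close> the left side vanishes.\<close>

lemma mult_ln_ratio_le:
  fixes u w :: real
  assumes "u \<ge> 0" "w > 0"
  shows "u * ln (w / u) \<le> w - u"
proof (cases "u = 0")
  case False
  then have "ln (w / u) \<le> w / u - 1" using assms by (intro ln_le_minus_one) auto
  then have "u * ln (w / u) \<le> u * (w / u - 1)" using assms by (intro mult_left_mono) auto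
  also have "\<dots> = w - u" using False by (simp add: field_simps)
  finally show ?thesis .
qed (use assms in simp)

text \<open>
  This is the chain rule for the entropy of a uniform element of \<open>U\<close>: each empty child of a node
  on the path costs at least \<open>1 / L\<close>. In the inductive step \<open>ln z \<le> z - 1\<close> is applied to the
  ratio of \<open>card U / L\<close> to the size of each branch.
\<close>

lemma sum_empty_cells_le:
  fixes L D a :: nat
  assumes "L > 0" "finite U" "U \<noteq> {}" "\<And>x. x \<in> U \<Longrightarrow> x div L ^ D = a"
  shows "(\<Sum>x\<in>U. real (card (empty_cells L D U x))) \<le> card U * (L * ln (real L ^ D / card U))"
  using assms(2-)
proof (induction D arbitrary: U a)
  case 0
  then have "U = {a}" by auto
  then show ?case by (simp add: empty_cells_def)
next
  case (Suc D)
  define E where "E = (\<lambda>x. x div L ^ D) ` U"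
  define W where "W e = {x\<in>U. x div L ^ D = e}" for e
  have finW: "finite (W e)" for e using Suc.prems by (simp add: W_def)
  have finE: "finite E" using Suc.prems by (simp add: E_def)
  have E_child: "e div L = a" if "e \<in> E" for e
    using that Suc.prems(3) by (auto simp: E_def mult.commute simp flip: div_mult2_eq)
  then have cE: "card E \<le> L"
  proof -
    have "E \<subseteq> {a * L..<a * L + L}" using E_child children_eq[OF \<open>L > 0\<close>, of a] by auto
    from card_mono[OF _ this] show ?thesis by simp
  qed
  have Wne: "card (W e) > 0" if "e \<in> E" for e
    using that finW by (auto simp: card_gt_0_iff W_def E_def)
  have split: "(\<Sum>x\<in>U. h x) = (\<Sum>e\<in>E. \<Sum>x\<in>W e. h x)" for h :: "nat \<Rightarrow> real"
    unfolding W_def E_def using Suc.prems(1) by (rule sum.image_gen)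
  have cardU: "real (card U) = (\<Sum>e\<in>E. real (card (W e)))"
    using split[of "\<lambda>_. 1"] by simp
  have Upos: "real (card U) > 0" using Suc.prems by (simp add: card_gt_0_iff)
  \<comment> \<open>At height \<open>D\<close> the empty cells are the children of \<open>a\<close>
    outside \<open>E\<close>; at lower heights only leaves with the same ancestor \<open>e\<close>
    as \<open>x\<close> can meet a cell, so \<open>U\<close> may be replaced by
    \<open>W e\<close>.\<close>
  have cells: "card (empty_cells L (Suc D) U x) = (L - card E) + card (empty_cells L D (W e) x)"
    if x: "x \<in> W e" for e x
  proof -
    have "empty_cells L (Suc D) U x
        = Pair D ` ({e. e div L = a} - E) \<union> empty_cells L D (W e) x" (is "?l = ?r")
    proof -
      have "(\<forall>x'\<in>U. x' div L ^ d \<noteq> c) \<longleftrightarrow> (\<forall>x'\<in>W e. x' div L ^ d \<noteq> c)"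
        if "d < D" "c div L = x div L ^ Suc d" for d c
      proof -
        have "x' div L ^ D = e" if "x' div L ^ d = c" for x'
        proof -
          have "x' div L ^ Suc d = x div L ^ Suc d"
            using that \<open>c div L = _\<close> by (metis div_mult2_eq power_Suc2)
          then have "x' div L ^ Suc d div L ^ (D - Suc d) = x div L ^ Suc d div L ^ (D - Suc d)"
            by simp
          moreover have "L ^ Suc d * L ^ (D - Suc d) = L ^ D"
            using \<open>d < D\<close> by (metis Suc_leI le_add_diff_inverse power_add)
          ultimately show ?thesis using x by (simp add: W_def flip: div_mult2_eq)
        qed
        then show ?thesis by (auto simp: W_def)
      qed
      moreover have "x div L ^ Suc D = a" using x Suc.prems(3) by (auto simp: W_def)
      moreover have "W e \<subseteq> U" by (auto simp: W_def)
      ultimately show ?thesis by (auto simp: empty_cells_def less_Suc_eq E_def)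
    qed
    moreover have "card (Pair D ` ({e. e div L = a} - E)) = L - card E"
    proof -
      have "card ({e. e div L = a} - E) = L - card E"
      proof -
        have "E \<subseteq> {e. e div L = a}" using E_child by auto
        from card_Diff_subset[OF finE this] show ?thesis by (simp add: children_eq[OF \<open>L > 0\<close>])
      qed
      then show ?thesis by (simp add: card_image inj_on_def)
    qed
    moreover have "Pair D ` ({e. e div L = a} - E) \<inter> empty_cells L D (W e) x = {}"
      by (auto simp: empty_cells_def)
    ultimately show ?thesis
      using finite_empty_cells[OF \<open>L > 0\<close>] by (simp add: card_Un_disjoint children_eq[OF \<open>L > 0\<close>])
  qed
  have "(\<Sum>x\<in>U. real (card (empty_cells L (Suc D) U x)))
      = (\<Sum>e\<in>E. \<Sum>x\<in>W e. real (L - card E) + real (card (empty_cells L D (W e) x)))"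
    by (simp add: split cells cong: sum.cong)
  also have "\<dots> = card U * real (L - card E) + (\<Sum>e\<in>E. \<Sum>x\<in>W e. real (card (empty_cells L D (W e) x)))"
    by (simp add: sum.distrib cardU sum_distrib_right)
  also have "(\<Sum>e\<in>E. \<Sum>x\<in>W e. real (card (empty_cells L D (W e) x)))
      \<le> (\<Sum>e\<in>E. card (W e) * (L * ln (real L ^ D / card (W e))))"
  proof (intro sum_mono)
    fix e assume "e \<in> E"
    then show "(\<Sum>x\<in>W e. real (card (empty_cells L D (W e) x))) \<le> card (W e) * (L * ln (real L ^ D / card (W e)))"
      using Wne finW by (intro Suc.IH[of "W e" e]) (auto simp: W_def E_def)
  qed
  also have "\<dots> \<le> (\<Sum>e\<in>E. L * (card U / L - card (W e)) + card (W e) * (L * ln (real L ^ Suc D / card U)))"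
  proof (intro sum_mono)
    fix e assume e: "e \<in> E"
    let ?u = "real (card (W e))"
    have "?u * ln (real L ^ D / ?u) = ?u * ln (card U / L / ?u) + ?u * ln (real L ^ Suc D / card U)"
    proof -
      have eq: "real L ^ D / ?u = (card U / L / ?u) * (real L ^ Suc D / card U)"
        using Upos \<open>L > 0\<close> by (simp add: field_simps)
      have "ln (real L ^ D / ?u) = ln (card U / L / ?u) + ln (real L ^ Suc D / card U)"
        unfolding eq using Upos \<open>L > 0\<close> Wne[OF e] by (intro ln_mult_pos) auto
      then show ?thesis by (simp only: distrib_left)
    qed
    also have "\<dots> \<le> (card U / L - ?u) + ?u * ln (real L ^ Suc D / card U)"
      using mult_ln_ratio_le[of ?u "card U / L"] Upos \<open>L > 0\<close> by simp
    finally have "L * (?u * ln (real L ^ D / ?u)) \<le> L * ((card U / L - ?u) + ?u * ln (real L ^ Suc D / card U))"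
      by (rule mult_left_mono) simp
    then show "?u * (L * ln (real L ^ D / ?u)) \<le> L * (card U / L - ?u) + ?u * (L * ln (real L ^ Suc D / card U))"
      by (simp only: distrib_left mult.left_commute)
  qed
  \<comment> \<open>The linear errors sum to \<open>card U * (card E - L)\<close> and exactly cancel
    the cost \<open>card U * (L - card E)\<close> of the top level.\<close>
  also have "\<dots> = card E * real (card U) - L * real (card U) + card U * (L * ln (real L ^ Suc D / card U))"
    using \<open>L > 0\<close> unfolding sum.distrib
    by (simp add: right_diff_distrib sum_subtractf flip: sum_distrib_left sum_distrib_right cardU)
  finally show ?case using cE by (simp add: of_nat_diff algebra_simps)
qed

section \<open>Cells off the path as disjoint intervals of rows\<close>

definition contains_perm :: "nat \<Rightarrow> (nat \<Rightarrow> nat) \<Rightarrow> (nat \<times> nat) set \<Rightarrow> bool" where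
  "contains_perm k \<pi> A \<longleftrightarrow> (\<exists>f g. strict_mono_on {..<k} f \<and> strict_mono_on {..<k} g \<and>
     (\<forall>i<k. (f i, g (\<pi> i)) \<in> A))"

text \<open>Unlike in \<open>empty_cells\<close>, the path itself is left out, which makes the leaf
  sets of the cells pairwise disjoint.\<close>

definition row_cells :: "nat \<Rightarrow> nat \<Rightarrow> nat \<Rightarrow> (nat \<times> nat) set" where
  "row_cells L D x = {(d, e). d < D \<and> e div L = x div L ^ Suc d \<and> e \<noteq> x div L ^ d}"

lemma row_cells_eq_SIGMA:
  "row_cells L D x = (SIGMA d:{..<D}. {e. e div L = x div L ^ Suc d} - {x div L ^ d})"
  by (auto simp: row_cells_def)

lemma finite_row_cells: "L > 0 \<Longrightarrow> finite (row_cells L D x)"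
  by (simp add: row_cells_eq_SIGMA children_eq)

lemma card_row_cells:
  assumes "L > 0" shows "card (row_cells L D x) = D * (L - 1)"
proof -
  have "card ({e. e div L = x div L ^ Suc d} - {x div L ^ d}) = L - 1" for d
  proof -
    have "x div L ^ d \<in> {e. e div L = x div L ^ Suc d}"
      by (simp add: mult.commute flip: div_mult2_eq)
    then show ?thesis by (simp add: card_Diff_singleton children_eq[OF assms])
  qed
  then show ?thesis using assms by (simp add: row_cells_eq_SIGMA card_SigmaI children_eq)
qed

text \<open>If \<open>d < d'\<close>, a leaf of the lower cell shares with \<open>x\<close> the
  ancestor at height \<open>Suc d\<close>, hence the one at height \<open>d'\<close>, while the cell
  at height \<open>d'\<close> is off the path.\<close>

lemma row_cells_disjoint:
  assumes "(d, e) \<in> row_cells L D x" "(d', e') \<in> row_cells L D x"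
    and "y div L ^ d = e" "y div L ^ d' = e'"
  shows "(d, e) = (d', e')"
proof -
  have *: "\<not> d < d'" if "(d, e) \<in> row_cells L D x" "(d', e') \<in> row_cells L D x"
    "y div L ^ d = e" "y div L ^ d' = e'" for d e d' e'
  proof
    assume "d < d'"
    have "y div L ^ Suc d = x div L ^ Suc d"
      using that by (auto simp: row_cells_def mult.commute simp flip: div_mult2_eq)
    then have "y div L ^ Suc d div L ^ (d' - Suc d) = x div L ^ Suc d div L ^ (d' - Suc d)"
      by simp
    moreover have "L ^ Suc d * L ^ (d' - Suc d) = L ^ d'"
      using \<open>d < d'\<close> by (metis Suc_leI le_add_diff_inverse power_add)
    ultimately have "y div L ^ d' = x div L ^ d'" by (simp flip: div_mult2_eq)
    then show False using that by (auto simp: row_cells_def)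
  qed
  show ?thesis
    using *[OF assms] *[OF assms(2,1,4,3)] assms(3,4) by (metis linorder_neqE_nat)
qed

text \<open>\<open>e * L ^ d\<close> is the leftmost leaf of the cell, so by disjointness it
  identifies the cell; it later serves to sort the cells.\<close>

lemma row_cells_inj:
  assumes "L > 0"
  shows "inj_on (\<lambda>(d, e). e * L ^ d) (row_cells L D x)"
proof (rule inj_onI, clarify)
  fix d e d' e' assume a: "(d, e) \<in> row_cells L D x" "(d', e') \<in> row_cells L D x"
    "e * L ^ d = e' * L ^ d'"
  have "(e * L ^ d) div L ^ d = e" using assms by simp
  moreover have "(e * L ^ d) div L ^ d' = e'" unfolding a(3) using assms by simp
  ultimately have "(d, e) = (d', e')" by (rule row_cells_disjoint[OF a(1,2)])
  then show "d = d' \<and> e = e'" by simp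
qed

text \<open>Disjoint cells are intervals of leaves, so their leftmost leaves decide the order of all
  their leaves.\<close>

lemma row_cells_ordered:
  assumes "L > 0" "(d, e) \<in> row_cells L D x" "(d', e') \<in> row_cells L D x"
    and "e * L ^ d < e' * L ^ d'" "y div L ^ d = e" "y' div L ^ d' = e'"
  shows "y < y'"
proof -
  let ?z = "e' * L ^ d'"
  have "?z div L ^ d \<noteq> e"
  proof
    assume "?z div L ^ d = e"
    moreover have "?z div L ^ d' = e'" using \<open>L > 0\<close> by simp
    ultimately have "(d, e) = (d', e')" by (rule row_cells_disjoint[OF assms(2,3)])
    then show False using assms(4) by simp
  qed
  moreover have "e \<le> ?z div L ^ d"
    using assms(1,4) by (simp add: less_eq_div_iff_mult_less_eq)
  ultimately have "y div L ^ d < ?z div L ^ d" using assms(5) by simp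
  then have "y < ?z" using div_le_mono leD linorder_le_less_linear by blast
  also have "?z \<le> y'" using assms(6) by auto
  finally show ?thesis .
qed

section \<open>Averaging over the ones of the matrix\<close>

lemma card_exceeding_le:
  fixes w :: "'a \<Rightarrow> real"
  assumes "finite X" "y > 0" "\<And>x. x \<in> X \<Longrightarrow> w x \<ge> 0" "sum w X \<le> real N * y"
  shows "card {x\<in>X. w x > y} \<le> N"
proof -
  have "card {x\<in>X. w x > y} * y = (\<Sum>x\<in>{x\<in>X. w x > y}. y)" by simp
  also have "\<dots> \<le> (\<Sum>x\<in>{x\<in>X. w x > y}. w x)" by (intro sum_mono) auto
  also have "\<dots> \<le> sum w X" using assms by (intro sum_mono2) auto
  also have "\<dots> \<le> real N * y" by (rule assms)
  finally show ?thesis using assms(2) by (simp add: mult_le_cancel_right)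
qed

lemma strict_mono_enumeration:
  fixes M :: "nat set"
  assumes "finite M" "N \<le> card M"
  obtains h where "strict_mono_on {..<N} h" "h ` {..<N} \<subseteq> M"
proof -
  obtain h where "bij_betw h {..<card M} M" "strict_mono_on {..<card M} h"
    using ex_bij_betw_strict_mono_card[OF assms(1)] .
  moreover have "{..<N} \<subseteq> {..<card M}" using assms(2) by auto
  ultimately show ?thesis
    by (intro that[of h]) (auto simp: bij_betw_def strict_mono_on_def)
qed

text \<open>For a uniformly random one, the entropy of the row given the column is at least
  \<open>ln (L ^ D) - ln (t / s)\<close>. So \<open>sum_empty_cells_le\<close>, averaged over the
  columns, costs only \<open>L * ln (t / s)\<close> per one, and some row does as well as the
  average.\<close>

lemma exists_row_with_few_empty_cells:
  fixes S :: "nat \<Rightarrow> nat set" and s t L D :: nat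
  assumes L: "L > 0" and s: "0 < s" and C: "finite C" "card C = t"
    and S: "\<And>x. x < L ^ D \<Longrightarrow> S x \<subseteq> C \<and> card (S x) = s"
  shows "\<exists>x<L ^ D. (\<Sum>c\<in>S x. real (card (empty_cells L D {x. x < L ^ D \<and> c \<in> S x} x)))
    \<le> s * (L * ln (t / s))"
proof -
  define m where "m = L ^ D"
  define U where "U c = {x. x < m \<and> c \<in> S x}" for c
  define z where "z c x = real (card (empty_cells L D (U c) x))" for c x
  have m: "m > 0" using L by (simp add: m_def)
  have fU: "finite (U c)" for c by (simp add: U_def)
  have st: "s \<le> t" using S[of 0] m C card_mono[OF C(1)] by (auto simp: m_def)
  have t: "t > 0" using st s by simp
  have swap: "(\<Sum>x<m. \<Sum>c\<in>S x. h c x) = (\<Sum>c\<in>C. \<Sum>x\<in>U c. h c x)" for h :: "nat \<Rightarrow> nat \<Rightarrow> real"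
  proof -
    have "(\<Sum>x<m. \<Sum>c\<in>S x. h c x) = (\<Sum>x<m. \<Sum>c\<in>C. if c \<in> S x then h c x else 0)"
      using S C(1) unfolding m_def by (intro sum.cong refl sum.mono_neutral_cong_left) auto
    also have "\<dots> = (\<Sum>c\<in>C. \<Sum>x<m. if c \<in> S x then h c x else 0)" by (rule sum.swap)
    also have "\<dots> = (\<Sum>c\<in>C. \<Sum>x\<in>U c. h c x)"
      unfolding U_def by (intro sum.cong refl sum.mono_neutral_cong_right) auto
    finally show ?thesis .
  qed
  have total: "(\<Sum>c\<in>C. real (card (U c))) = m * s"
    using swap[of "\<lambda>_ _. 1"] S by (simp add: m_def)
  have "(\<Sum>x<m. \<Sum>c\<in>S x. z c x) = (\<Sum>c\<in>C. \<Sum>x\<in>U c. z c x)" by (rule swap)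
  also have "\<dots> \<le> (\<Sum>c\<in>C. L * (real (m * s) / t - card (U c) + card (U c) * ln (t / s)))"
  proof (intro sum_mono)
    fix c assume "c \<in> C"
    let ?u = "real (card (U c))"
    have "(\<Sum>x\<in>U c. z c x) \<le> ?u * (L * ln (m / ?u))"
    proof (cases "U c = {}")
      case False
      have "(\<Sum>x\<in>U c. z c x) \<le> ?u * (L * ln (real L ^ D / ?u))"
        unfolding z_def using False L fU
        by (intro sum_empty_cells_le[where a = 0]) (auto simp: U_def m_def)
      then show ?thesis by (simp add: m_def)
    qed simp
    also have "\<dots> = L * (?u * ln (m / ?u))" by simp
    \<comment> \<open>The column size is compared with the mean \<open>m * s / t\<close>; the linear
      errors of \<open>mult_ln_ratio_le\<close> cancel in the sum over \<open>C\<close>, where the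
      sizes add up to \<open>m * s\<close>.\<close>
    also have "?u * ln (m / ?u) = ?u * ln (real (m * s) / t / ?u) + ?u * ln (t / s)"
    proof (cases "U c = {}")
      case False
      then have "?u > 0" using fU by (simp add: card_gt_0_iff)
      moreover have "m / ?u = (real (m * s) / t / ?u) * (t / s)" using s t by simp
      ultimately show ?thesis
        using s t m by (metis distrib_left divide_pos_pos ln_mult_pos mult_pos_pos of_nat_0_less_iff)
    qed simp
    also have "\<dots> \<le> real (m * s) / t - ?u + ?u * ln (t / s)"
      using mult_ln_ratio_le[of ?u "real (m * s) / t"] m s t by simp
    finally show "(\<Sum>x\<in>U c. z c x) \<le> L * (real (m * s) / t - ?u + ?u * ln (t / s))"
      by (simp add: mult_left_mono)
  qed
  also have "\<dots> = L * (m * s * ln (t / s))"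
    using t by (simp add: sum.distrib sum_subtractf total C(2) flip: sum_distrib_left sum_distrib_right)
  finally have "(\<Sum>x\<in>{..<m}. \<Sum>c\<in>S x. z c x) \<le> card {..<m} * (s * (L * ln (t / s)))"
    by (simp add: mult_ac)
  moreover have "{..<m} \<noteq> {}" using m by auto
  ultimately obtain x where "x < m" "(\<Sum>c\<in>S x. z c x) \<le> s * (L * ln (t / s))"
    using exists_below_average[of "{..<m}"] by blast
  then show ?thesis unfolding z_def U_def m_def by blast
qed

text \<open>For a row \<open>x\<close> as above, the contracted matrix has the cells off the path to
  \<open>x\<close> as rows and \<open>S x\<close> as columns, with a zero where a cell misses a
  column. Discarding the rows and columns with more than \<open>y\<close> zeros leaves at least
  \<open>N\<close> of each, and a copy placed off the zeros lifts to leaves.\<close>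

lemma dense_rows_contain_scattered:
  fixes S :: "nat \<Rightarrow> nat set" and s t L D p B r k :: nat
  assumes L: "L > 0" and p: "p > 0" and B: "B > 0" and r: "r > 0" and kB: "k \<le> B * p"
    and sc: "scattered p r k \<pi>" and \<pi>: "\<And>i. i < k \<Longrightarrow> \<pi> i < k"
    and s: "s = 4 * p * B" and st: "s < t" and D: "s \<le> D * (L - 1)"
    and C: "finite C" "card C = t"
    and S: "\<And>x. x < L ^ D \<Longrightarrow> S x \<subseteq> C \<and> card (S x) = s"
    and T: "ln B + 4 < p / (r * (2 * L * ln (t / s)))"
  shows "contains_perm k \<pi> {(x, c). x < L ^ D \<and> c \<in> S x}"
proof -
  \<comment> \<open>\<open>N\<close> is the side needed in
    \<open>scattered_avoids_sparse_zeros\<close>. As \<open>s = 2 * N\<close> and \<open>y\<close>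
    is twice the average, at most half of the columns are lost.\<close>
  define N where "N = 2 * p * B"
  define y where "y = 2 * L * ln (t / s)"
  define U where "U c = {x. x < L ^ D \<and> c \<in> S x}" for c
  define empty where "empty = (\<lambda>(d, e) c. \<forall>x'\<in>U c. x' div L ^ d \<noteq> e)"
  have s0: "s > 0" using s p B by simp
  have y: "y > 0" using L s0 st by (simp add: y_def)
  have "\<exists>x<L ^ D. (\<Sum>c\<in>S x. real (card (empty_cells L D (U c) x))) \<le> s * (L * ln (t / s))"
    unfolding U_def by (rule exists_row_with_few_empty_cells[OF L s0 C S])
  then obtain x where x: "x < L ^ D"
    "(\<Sum>c\<in>S x. real (card (empty_cells L D (U c) x))) \<le> N * y"
    using s by (auto simp: N_def y_def mult_ac)
  have fS: "finite (S x)" and cS: "card (S x) = 2 * N"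
    using S[OF x(1)] C(1) s finite_subset by (auto simp: N_def)
  define Q where "Q = row_cells L D x"
  have fQ: "finite Q" unfolding Q_def using L by (rule finite_row_cells)
  have cQ: "card Q \<ge> 2 * N" using card_row_cells[OF L] D s by (simp add: Q_def N_def)
  have sub: "{q\<in>Q. empty q c} \<subseteq> empty_cells L D (U c) x" for c
    by (auto simp: Q_def row_cells_def empty_def empty_cells_def)
  have le: "card {q\<in>Q. empty q c} \<le> card (empty_cells L D (U c) x)" for c
    by (rule card_mono[OF finite_empty_cells[OF L] sub])
  define Gc where "Gc = {c\<in>S x. \<not> real (card (empty_cells L D (U c) x)) > y}"
  define Gr where "Gr = {q\<in>Q. \<not> real (card {c\<in>S x. empty q c}) > y}"
  have cGc: "card Gc \<ge> N"
  proof -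
    have "card {c\<in>S x. real (card (empty_cells L D (U c) x)) > y} \<le> N"
      using fS y x(2) by (intro card_exceeding_le) auto
    moreover have "Gc = S x - {c\<in>S x. real (card (empty_cells L D (U c) x)) > y}"
      by (auto simp: Gc_def)
    ultimately show ?thesis using fS cS by (simp add: card_Diff_subset)
  qed
  have cGr: "card Gr \<ge> N"
  proof -
    \<comment> \<open>The same zeros counted by rows: there are at most \<open>N * y\<close>, so at
      most \<open>N\<close> of the at least \<open>2 * N\<close> rows are lost.\<close>
    have "(\<Sum>q\<in>Q. card {c\<in>S x. empty q c}) = (\<Sum>c\<in>S x. card {q\<in>Q. empty q c})"
      using sum.swap_restrict[OF fQ fS, of "\<lambda>_ _. 1::nat" empty] by simp
    also have "\<dots> \<le> (\<Sum>c\<in>S x. card (empty_cells L D (U c) x))" using le by (intro sum_mono)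
    finally have "(\<Sum>q\<in>Q. real (card {c\<in>S x. empty q c})) \<le> N * y"
      using x(2) by (simp flip: of_nat_sum)
    then have "card {q\<in>Q. real (card {c\<in>S x. empty q c}) > y} \<le> N"
      using fQ y by (intro card_exceeding_le) auto
    moreover have "Gr = Q - {q\<in>Q. real (card {c\<in>S x. empty q c}) > y}"
      by (auto simp: Gr_def)
    ultimately show ?thesis using fQ cQ by (simp add: card_Diff_subset)
  qed
  define key where "key = (\<lambda>(d::nat, e). e * L ^ d)"
  have inj: "inj_on key Gr"
    using row_cells_inj[OF L] unfolding key_def
    by (rule inj_on_subset) (auto simp: Gr_def Q_def)
  have "finite (key ` Gr)" "N \<le> card (key ` Gr)"
    using fQ cGr inj by (auto simp: card_image Gr_def)
  then obtain h where h: "strict_mono_on {..<N} h" "h ` {..<N} \<subseteq> key ` Gr"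
    by (rule strict_mono_enumeration)
  \<comment> \<open>\<open>\<rho>\<close> lists \<open>N\<close> of the kept cells by increasing
    leftmost leaf.\<close>
  define \<rho> where "\<rho> = the_inv_into Gr key \<circ> h"
  have \<rho>: "\<rho> a \<in> Gr" "key (\<rho> a) = h a" if "a < N" for a
    using h(2) that inj unfolding \<rho>_def
    by (auto intro!: the_inv_into_into f_the_inv_into_f)
  have "finite Gc" using fS by (simp add: Gc_def)
  then obtain \<kappa> where \<kappa>: "strict_mono_on {..<N} \<kappa>" "\<kappa> ` {..<N} \<subseteq> Gc"
    using cGc by (rule strict_mono_enumeration)
  have inj\<rho>: "inj_on \<rho> {..<N}"
    using strict_mono_on_imp_inj_on[OF h(1)] \<rho>(2) by (metis inj_on_def lessThan_iff)
  have rows: "real (card {b. b < 2*p*B \<and> empty (\<rho> a) (\<kappa> b)}) \<le> y" if "a < 2*p*B" for a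
  proof -
    have "card {b. b < 2*p*B \<and> empty (\<rho> a) (\<kappa> b)} \<le> card {c\<in>S x. empty (\<rho> a) c}"
    proof (rule card_inj_on_le[of \<kappa>])
      show "inj_on \<kappa> {b. b < 2*p*B \<and> empty (\<rho> a) (\<kappa> b)}"
        using strict_mono_on_imp_inj_on[OF \<kappa>(1)] by (rule inj_on_subset) (auto simp: N_def)
    qed (use \<kappa>(2) fS in \<open>auto simp: N_def Gc_def\<close>)
    moreover have "real (card {c\<in>S x. empty (\<rho> a) c}) \<le> y"
      using \<rho>(1)[of a] that by (auto simp: Gr_def N_def)
    ultimately show ?thesis by linarith
  qed
  have cols: "real (card {a. a < 2*p*B \<and> empty (\<rho> a) (\<kappa> b)}) \<le> y" if b: "b < 2*p*B" for b
  proof -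
    have "card {a. a < 2*p*B \<and> empty (\<rho> a) (\<kappa> b)} \<le> card {q\<in>Q. empty q (\<kappa> b)}"
    proof (rule card_inj_on_le[of \<rho>])
      show "inj_on \<rho> {a. a < 2*p*B \<and> empty (\<rho> a) (\<kappa> b)}"
        using inj\<rho> by (rule inj_on_subset) (auto simp: N_def)
    qed (use \<rho>(1) fQ in \<open>auto simp: N_def Gr_def\<close>)
    moreover have "real (card (empty_cells L D (U (\<kappa> b)) x)) \<le> y"
      using \<kappa>(2) b by (auto simp: Gc_def N_def)
    ultimately show ?thesis using le[of "\<kappa> b"] by linarith
  qed
  have T': "ln B + 4 < p / (r * y)" using T by (simp add: y_def)
  obtain f g where fg: "strict_mono_on {..<k} f" "strict_mono_on {..<k} g"
    "f ` {..<k} \<subseteq> {..<N}" "g ` {..<k} \<subseteq> {..<N}" "\<forall>i<k. \<not> empty (\<rho> (f i)) (\<kappa> (g (\<pi> i)))"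
    using scattered_avoids_sparse_zeros[OF p kB B r y sc \<pi>, of "\<lambda>a b. empty (\<rho> a) (\<kappa> b)", OF _ rows cols T']
    unfolding N_def by blast
  \<comment> \<open>A nonzero entry of the contracted matrix provides a leaf of the cell whose row
    has a one in that column.\<close>
  have "\<forall>i. \<exists>x'. i < k \<longrightarrow> x' \<in> U (\<kappa> (g (\<pi> i))) \<and> x' div L ^ fst (\<rho> (f i)) = snd (\<rho> (f i))"
    using fg(5) by (fastforce simp: empty_def split: prod.splits)
  then obtain xs where xs: "\<And>i. i < k \<Longrightarrow> xs i \<in> U (\<kappa> (g (\<pi> i)))"
    "\<And>i. i < k \<Longrightarrow> xs i div L ^ fst (\<rho> (f i)) = snd (\<rho> (f i))"
    by metis
  have "strict_mono_on {..<k} xs"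
  proof (rule strict_mono_onI)
    fix i j assume ij: "i \<in> {..<k}" "j \<in> {..<k}" "i < j"
    have fN: "f i < N" "f j < N" using fg(3) ij by (auto simp: image_subset_iff)
    have "f i < f j" using fg(1) ij by (auto simp: strict_mono_on_def)
    then have "h (f i) < h (f j)" using h(1) fN by (auto simp: strict_mono_on_def)
    then have "key (\<rho> (f i)) < key (\<rho> (f j))" using \<rho>(2) fN by simp
    moreover have "\<rho> (f i) \<in> row_cells L D x" "\<rho> (f j) \<in> row_cells L D x"
      using \<rho>(1) fN by (auto simp: Gr_def Q_def)
    ultimately show "xs i < xs j"
      using row_cells_ordered[OF L, of "fst (\<rho> (f i))" "snd (\<rho> (f i))" D x
          "fst (\<rho> (f j))" "snd (\<rho> (f j))" "xs i" "xs j"] xs(2) ij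
      by (auto simp: key_def split: prod.splits)
  qed
  moreover have "strict_mono_on {..<k} (\<kappa> \<circ> g)"
    using \<kappa>(1) fg(2,4) by (auto simp: strict_mono_on_def image_subset_iff)
  moreover have "\<forall>i<k. (xs i, (\<kappa> \<circ> g) (\<pi> i)) \<in> {(x, c). x < L ^ D \<and> c \<in> S x}"
    using xs(1) by (auto simp: U_def)
  ultimately show ?thesis unfolding contains_perm_def by blast
qed

subsection \<open>The recursion of Marcus and Tardos\<close>

lemma inverse_on_lessThan:
  assumes "bij_betw \<pi> {..<k} {..<k::nat}"
  defines "\<tau> \<equiv> inv_into {..<k} \<pi>"
  shows "bij_betw \<tau> {..<k} {..<k}" "\<And>i. i < k \<Longrightarrow> \<tau> (\<pi> i) = i" "\<And>i. i < k \<Longrightarrow> \<pi> (\<tau> i) = i"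
  using assms by (simp_all add: bij_betw_inv_into bij_betw_inv_into_left bij_betw_inv_into_right)

text \<open>\<open>R\<close> and \<open>T\<close> relate contracted indices to original ones. Each
  column of the pattern holds exactly one point, so its original column is chosen through that point
  and reindexed by the inverse of \<open>\<pi>\<close>.\<close>

lemma contains_perm_lift:
  assumes A': "contains_perm k \<pi> A'" and \<pi>: "bij_betw \<pi> {..<k} {..<k}"
    and lift: "\<And>a b. (a, b) \<in> A' \<Longrightarrow> \<exists>x y. (x, y) \<in> A \<and> R a x \<and> T b y"
    and R: "\<And>a a' x x'. R a x \<Longrightarrow> R a' x' \<Longrightarrow> a < a' \<Longrightarrow> x < x'"
    and T: "\<And>b b' y y'. T b y \<Longrightarrow> T b' y' \<Longrightarrow> b < b' \<Longrightarrow> y < y'"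
  shows "contains_perm k \<pi> A"
proof -
  obtain f g where fg: "strict_mono_on {..<k} f" "strict_mono_on {..<k} g"
    "\<forall>i<k. (f i, g (\<pi> i)) \<in> A'"
    using A' unfolding contains_perm_def by blast
  have "\<forall>i. \<exists>x y. i < k \<longrightarrow> (x, y) \<in> A \<and> R (f i) x \<and> T (g (\<pi> i)) y"
    using lift fg(3) by blast
  then obtain X Y where XY: "\<And>i. i < k \<Longrightarrow> (X i, Y i) \<in> A \<and> R (f i) (X i) \<and> T (g (\<pi> i)) (Y i)"
    by metis
  define \<tau> where "\<tau> = inv_into {..<k} \<pi>"
  note inv = inverse_on_lessThan[OF \<pi>, folded \<tau>_def]
  have \<tau>: "\<tau> j < k" if "j < k" for j
    using inv(1) that by (auto simp: bij_betw_def)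
  have "strict_mono_on {..<k} X"
  proof (rule strict_mono_onI)
    fix i j assume ij: "i \<in> {..<k}" "j \<in> {..<k}" "i < j"
    then have "f i < f j" using fg(1) by (auto simp: strict_mono_on_def)
    then show "X i < X j" using XY[of i] XY[of j] ij R[of "f i" "X i" "f j" "X j"] by simp
  qed
  moreover have "strict_mono_on {..<k} (Y \<circ> \<tau>)"
  proof (rule strict_mono_onI)
    fix i j assume ij: "i \<in> {..<k}" "j \<in> {..<k}" "i < j"
    then have "g i < g j" using fg(2) by (auto simp: strict_mono_on_def)
    then show "(Y \<circ> \<tau>) i < (Y \<circ> \<tau>) j"
      using XY[OF \<tau>, of i] XY[OF \<tau>, of j] inv(3) ij T[of "g i" "Y (\<tau> i)" "g j" "Y (\<tau> j)"] by simp
  qed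
  moreover have "\<forall>i<k. (X i, (Y \<circ> \<tau>) (\<pi> i)) \<in> A" using XY inv(2) by simp
  ultimately show ?thesis unfolding contains_perm_def by blast
qed

lemma contains_perm_mono: "contains_perm k \<pi> A \<Longrightarrow> A \<subseteq> A' \<Longrightarrow> contains_perm k \<pi> A'"
  unfolding contains_perm_def by blast

lemma contains_perm_converse:
  assumes \<pi>: "bij_betw \<pi> {..<k} {..<k}" and A: "contains_perm k (inv_into {..<k} \<pi>) (A\<inverse>)"
  shows "contains_perm k \<pi> A"
proof -
  let ?\<tau> = "inv_into {..<k} \<pi>"
  obtain f g where fg: "strict_mono_on {..<k} f" "strict_mono_on {..<k} g"
    "\<forall>i<k. (g (?\<tau> i), f i) \<in> A"
    using A unfolding contains_perm_def by auto
  have "(g i, f (\<pi> i)) \<in> A" if "i < k" for i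
    using fg(3)[rule_format, of "\<pi> i"] inverse_on_lessThan(2)[OF \<pi> that] \<pi> that
    by (auto simp: bij_betw_def)
  then show ?thesis using fg unfolding contains_perm_def by blast
qed

lemma scattered_inverse:
  assumes \<pi>: "bij_betw \<pi> {..<k} {..<k}" and sc: "scattered p r k \<pi>"
  shows "scattered p r k (inv_into {..<k} \<pi>)"
  unfolding scattered_def
proof (intro allI)
  fix a b
  let ?\<tau> = "inv_into {..<k} \<pi>"
  have \<tau>: "?\<tau> i < k" if "i < k" for i
    using inverse_on_lessThan(1)[OF \<pi>] that by (auto simp: bij_betw_def)
  have "card {i. i < k \<and> i \<in> {a..<a+p} \<and> ?\<tau> i \<in> {b..<b+p}}
      \<le> card {i. i < k \<and> i \<in> {b..<b+p} \<and> \<pi> i \<in> {a..<a+p}}"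
  proof (rule card_inj_on_le[of ?\<tau>])
    show "inj_on ?\<tau> {i. i < k \<and> i \<in> {a..<a+p} \<and> ?\<tau> i \<in> {b..<b+p}}"
      using inverse_on_lessThan(1)[OF \<pi>] unfolding bij_betw_def
      by (elim conjE inj_on_subset) auto
  qed (use \<tau> inverse_on_lessThan(3)[OF \<pi>] in auto)
  also have "\<dots> \<le> r" using sc unfolding scattered_def by blast
  finally show "card {i. i < k \<and> i \<in> {a..<a+p} \<and> ?\<tau> i \<in> {b..<b+p}} \<le> r" .
qed

text \<open>In the recursion the \<open>s\<^sup>2\<close> columns are those of one block column, and
  each row stands for a block, with \<open>s\<close> of its nonempty columns.\<close>

definition row_unavoidable :: "nat \<Rightarrow> nat \<Rightarrow> nat \<Rightarrow> (nat \<Rightarrow> nat) \<Rightarrow> bool" where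
  "row_unavoidable m s k \<pi> \<longleftrightarrow> (\<forall>S C. finite C \<and> card C = s\<^sup>2 \<and>
     (\<forall>x<m. S x \<subseteq> C \<and> card (S x) = s) \<longrightarrow> contains_perm k \<pi> {(x, c). x < m \<and> c \<in> S x})"

definition block_cols :: "(nat \<times> nat) set \<Rightarrow> nat \<Rightarrow> nat \<Rightarrow> nat \<Rightarrow> nat set" where
  "block_cols A t I J = {y. \<exists>x. (x, y) \<in> A \<and> x div t = I \<and> y div t = J}"

lemma finite_block_cols: "finite A \<Longrightarrow> finite (block_cols A t I J)"
  by (rule finite_subset[of _ "snd ` A"]) (force simp: block_cols_def)+

text \<open>Contract each of \<open>m\<close> wide blocks in one block column to a row and keep
  \<open>s\<close> of its nonempty columns. A copy of the pattern there lifts, since the blocks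
  occupy disjoint intervals of rows.\<close>

lemma card_wide_blocks_le:
  assumes A: "finite A" "\<not> contains_perm k \<pi> A" and \<pi>: "bij_betw \<pi> {..<k} {..<k}"
    and s: "s > 0" and W: "row_unavoidable m s k \<pi>"
  shows "card {I. s \<le> card (block_cols A (s\<^sup>2) I J)} \<le> m" (is "card ?W \<le> m")
    and "finite {I. s \<le> card (block_cols A (s\<^sup>2) I J)}"
proof -
  let ?t = "s\<^sup>2"
  show fin: "finite ?W"
  proof (rule finite_subset[of _ "(\<lambda>q. fst q div ?t) ` A"])
    show "?W \<subseteq> (\<lambda>q. fst q div ?t) ` A"
    proof
      fix I assume "I \<in> ?W"
      then have "block_cols A ?t I J \<noteq> {}" using s by auto
      then show "I \<in> (\<lambda>q. fst q div ?t) ` A" by (force simp: block_cols_def)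
    qed
  qed (use A in simp)
  show "card ?W \<le> m"
  proof (rule ccontr)
    assume "\<not> card ?W \<le> m"
    then obtain h where h: "strict_mono_on {..<m} h" "h ` {..<m} \<subseteq> ?W"
      using strict_mono_enumeration[OF fin, of m] by (metis linorder_le_cases)
    have "\<forall>x. \<exists>T. x < m \<longrightarrow> T \<subseteq> block_cols A ?t (h x) J \<and> card T = s"
    proof
      fix x
      show "\<exists>T. x < m \<longrightarrow> T \<subseteq> block_cols A ?t (h x) J \<and> card T = s"
      proof (cases "x < m")
        case True
        then have "s \<le> card (block_cols A ?t (h x) J)" using h(2) by auto
        then obtain T where "T \<subseteq> block_cols A ?t (h x) J" "card T = s"
          by (rule obtain_subset_with_card_n)
        then show ?thesis by blast
      qed simp
    qed
    then obtain S where S: "\<And>x. x < m \<Longrightarrow> S x \<subseteq> block_cols A ?t (h x) J \<and> card (S x) = s"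
      by metis
    define C where "C = {y. y div ?t = J}"
    have "finite C" "card C = ?t"
      using children_eq[of ?t J] s by (simp_all add: C_def)
    moreover have "S x \<subseteq> C" if "x < m" for x
      using S[OF that] by (auto simp: block_cols_def C_def)
    ultimately have "contains_perm k \<pi> {(x, c). x < m \<and> c \<in> S x}"
      using W S unfolding row_unavoidable_def by blast
    then have "contains_perm k \<pi> A"
    proof (rule contains_perm_lift[OF _ \<pi>, where R = "\<lambda>i x. i < m \<and> x div ?t = h i" and T = "(=)"])
      fix a b assume "(a, b) \<in> {(x, c). x < m \<and> c \<in> S x}"
      then show "\<exists>x y. (x, y) \<in> A \<and> (a < m \<and> x div ?t = h a) \<and> b = y"
        using S[of a] by (auto simp: block_cols_def)
    next
      fix a a' x x' assume "a < m \<and> x div ?t = h a" "a' < m \<and> x' div ?t = h a'" "a < a'"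
      then have "x div ?t < x' div ?t" using h(1) by (auto simp: strict_mono_on_def)
      then show "x < x'" using div_le_mono leD linorder_le_less_linear by blast
    qed auto
    then show False using A by simp
  qed
qed

text \<open>Blocks have side \<open>s\<^sup>2\<close>. The contracted matrix avoids the pattern
  again, a block neither wide nor tall holds at most \<open>(s - 1)\<^sup>2\<close> ones, and there
  are at most \<open>m\<close> wide blocks per block column and \<open>m\<close> tall ones per block
  row.\<close>

lemma marcus_tardos:
  assumes \<pi>: "bij_betw \<pi> {..<k} {..<k}" and s: "s \<ge> 2"
    and W: "row_unavoidable m s k \<pi>" "row_unavoidable m s k (inv_into {..<k} \<pi>)"
  shows "A \<subseteq> {..<n} \<times> {..<n} \<Longrightarrow> \<not> contains_perm k \<pi> A \<Longrightarrow> card A \<le> 2 * (m + 1) * s ^ 3 * n"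
proof (induction n arbitrary: A rule: less_induct)
  case (less n)
  show ?case
  proof (cases "n = 0")
    case True
    then show ?thesis using less.prems by simp
  next
    case False
    define c where "c = 2 * (m + 1) * s ^ 3"
    define t where "t = s\<^sup>2"
    define n' where "n' = n div t"
    have t: "t > 1" using s unfolding t_def by (intro one_less_power) auto
    have n'n: "n' < n" using False t by (simp add: n'_def)
    have tn: "t * n' \<le> n" by (simp add: n'_def)
    have finA: "finite A" using less.prems(1) finite_subset by blast
    define A0 where "A0 = A \<inter> {..<t * n'} \<times> {..<t * n'}"
    define \<phi> where "\<phi> = (\<lambda>(x, y). (x div t, y div t :: nat))"
    have finA0: "finite A0" using finA by (simp add: A0_def)
    have nc: "\<not> contains_perm k \<pi> A0"
      using less.prems(2) contains_perm_mono[of k \<pi> A0 A] by (auto simp: A0_def)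
    have nc': "\<not> contains_perm k \<pi> (\<phi> ` A0)"
    proof
      assume "contains_perm k \<pi> (\<phi> ` A0)"
      then have "contains_perm k \<pi> A0"
      proof (rule contains_perm_lift[OF _ \<pi>, where R = "\<lambda>i x. x div t = i" and T = "\<lambda>i x. x div t = i"])
        fix a b assume "(a, b) \<in> \<phi> ` A0"
        then show "\<exists>x y. (x, y) \<in> A0 \<and> x div t = a \<and> y div t = b" by (auto simp: \<phi>_def)
      next
        fix a a' x x' :: nat assume "x div t = a" "x' div t = a'" "a < a'"
        then show "x < x'" using div_le_mono leD linorder_le_less_linear by blast
      next
        fix a a' x x' :: nat assume "x div t = a" "x' div t = a'" "a < a'"
        then show "x < x'" using div_le_mono leD linorder_le_less_linear by blast
      qed
      then show False using nc by simp
    qed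
    have sub: "\<phi> ` A0 \<subseteq> {..<n'} \<times> {..<n'}"
      using t by (auto simp: \<phi>_def A0_def div_less_iff_less_mult mult.commute)
    have IH: "card (\<phi> ` A0) \<le> c * n'" unfolding c_def by (rule less.IH[OF n'n sub nc'])
    define wide where "wide = (\<lambda>(I, J). s \<le> card (block_cols A0 t I J))"
    \<comment> \<open>Rows are treated as columns of the transpose, hence the exchanged block
      indices.\<close>
    define tall where "tall = (\<lambda>(I, J). s \<le> card (block_cols (A0\<inverse>) t J I))"
    have fibre: "card {q\<in>A0. \<phi> q = b} \<le> (s-1)*(s-1) + (of_bool (wide b) + of_bool (tall b)) * (t*t)" for b
    proof -
      obtain I J where b: "b = (I, J)" by fastforce
      have subX: "{q\<in>A0. \<phi> q = b} \<subseteq> block_cols (A0\<inverse>) t J I \<times> block_cols A0 t I J"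
        by (auto simp: \<phi>_def b block_cols_def)
      have fX: "finite (block_cols (A0\<inverse>) t J I)" "finite (block_cols A0 t I J)"
        using finA0 by (auto intro: finite_block_cols)
      have le: "card {q\<in>A0. \<phi> q = b} \<le> card (block_cols (A0\<inverse>) t J I) * card (block_cols A0 t I J)"
        using card_mono[OF _ subX] fX by (simp add: card_cartesian_product)
      have ct: "card {y. y div t = J} = t" "finite {y. y div t = J}" for J
        using children_eq[of t J] t by simp_all
      have le_t: "card (block_cols X t I J) \<le> t" for X I J
        using card_mono[OF ct(2)[of J], of "block_cols X t I J"] ct(1)[of J] by (auto simp: block_cols_def)
      show ?thesis
      proof (cases "wide b \<or> tall b")
        case True
        have "card {q\<in>A0. \<phi> q = b} \<le> t * t" using le mult_le_mono[OF le_t le_t] by (rule order_trans)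
        then show ?thesis using True by auto
      next
        case False
        then have "card (block_cols (A0\<inverse>) t J I) \<le> s - 1" "card (block_cols A0 t I J) \<le> s - 1"
          by (auto simp: wide_def tall_def b)
        from mult_le_mono[OF this] le show ?thesis by linarith
      qed
    qed
    have \<tau>: "bij_betw (inv_into {..<k} \<pi>) {..<k} {..<k}" by (rule inverse_on_lessThan(1)[OF \<pi>])
    have s0: "s > 0" using s by simp
    define \<Phi> where "\<Phi> = \<phi> ` A0"
    have sub\<Phi>: "\<Phi> \<subseteq> {..<n'} \<times> {..<n'}" using sub by (simp add: \<Phi>_def)
    have nwide: "card {b\<in>\<Phi>. wide b} \<le> n' * m"
    proof -
      let ?W = "\<lambda>J. {I. s \<le> card (block_cols A0 t I J)}"
      note W' = card_wide_blocks_le[OF finA0 nc \<pi> s0 W(1), folded t_def]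
      have "card {b\<in>\<Phi>. wide b} \<le> card (SIGMA J:{..<n'}. ?W J)"
      proof (rule card_inj_on_le[of prod.swap])
        show "prod.swap ` {b\<in>\<Phi>. wide b} \<subseteq> (SIGMA J:{..<n'}. ?W J)"
          using sub\<Phi> by (auto simp: wide_def)
      qed (use W'(2) in auto)
      also have "\<dots> = (\<Sum>J<n'. card (?W J))" using W'(2) by (simp add: card_SigmaI)
      also have "\<dots> \<le> n' * m" using sum_mono[of "{..<n'}" "\<lambda>J. card (?W J)" "\<lambda>_. m"] W'(1) by simp
      finally show ?thesis .
    qed
    have ntall: "card {b\<in>\<Phi>. tall b} \<le> n' * m"
    proof -
      let ?W = "\<lambda>J. {I. s \<le> card (block_cols (A0\<inverse>) t I J)}"
      have "\<not> contains_perm k (inv_into {..<k} \<pi>) (A0\<inverse>)"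
        using contains_perm_converse[OF \<pi>] nc by blast
      note W' = card_wide_blocks_le[OF _ this \<tau> s0 W(2), folded t_def, unfolded finite_converse, OF finA0]
      have "card {b\<in>\<Phi>. tall b} \<le> card (SIGMA J:{..<n'}. ?W J)"
      proof (rule card_inj_on_le[of id])
        show "id ` {b\<in>\<Phi>. tall b} \<subseteq> (SIGMA J:{..<n'}. ?W J)"
          using sub\<Phi> by (auto simp: tall_def)
      qed (use W'(2) in auto)
      also have "\<dots> = (\<Sum>J<n'. card (?W J))" using W'(2) by (simp add: card_SigmaI)
      also have "\<dots> \<le> n' * m" using sum_mono[of "{..<n'}" "\<lambda>J. card (?W J)" "\<lambda>_. m"] W'(1) by simp
      finally show ?thesis .
    qed
    have "card A0 = (\<Sum>b\<in>\<phi> ` A0. card {q\<in>A0. \<phi> q = b})"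
      using sum.image_gen[OF finA0, of "\<lambda>_. 1::nat" \<phi>] by simp
    also have "\<dots> \<le> (\<Sum>b\<in>\<phi> ` A0. (s-1)*(s-1) + (of_bool (wide b) + of_bool (tall b)) * (t*t))"
      using fibre by (intro sum_mono)
    also have "\<dots> = card (\<phi> ` A0) * ((s-1)*(s-1))
        + (card {b\<in>\<phi> ` A0. wide b} + card {b\<in>\<phi> ` A0. tall b}) * (t*t)"
      using finA0 by (simp add: sum.distrib Int_def flip: sum_distrib_right)
    also have "\<dots> \<le> (c * n') * ((s-1)*(s-1)) + (n' * m + n' * m) * (t*t)"
      by (intro add_mono mult_le_mono1 IH nwide[unfolded \<Phi>_def] ntall[unfolded \<Phi>_def])
    finally have A0: "card A0 \<le> (c * n') * ((s-1)*(s-1)) + (n' * m + n' * m) * (t*t)" .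
    \<comment> \<open>Fewer than \<open>t\<close> rows and fewer than \<open>t\<close> columns lie
      beyond the last complete block.\<close>
    have rest: "card (A - A0) \<le> 2 * t * n"
    proof -
      have "A - A0 \<subseteq> {t*n'..<n} \<times> {..<n} \<union> {..<n} \<times> {t*n'..<n}"
        using less.prems(1) by (auto simp: A0_def)
      then have "card (A - A0) \<le> card ({t*n'..<n} \<times> {..<n} \<union> {..<n} \<times> {t*n'..<n})"
        by (intro card_mono) auto
      also have "\<dots> \<le> card ({t*n'..<n} \<times> {..<n}) + card ({..<n} \<times> {t*n'..<n})" by (rule card_Un_le)
      also have "\<dots> = 2 * (n mod t) * n"
        by (simp add: card_cartesian_product n'_def minus_mult_div_eq_mod)
      also have "\<dots> \<le> 2 * t * n" using t by (intro mult_le_mono) auto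
      finally show ?thesis .
    qed
    have "card A \<le> card A0 + card (A - A0)"
    proof -
      have "A0 \<union> (A - A0) = A" by (auto simp: A0_def)
      then show ?thesis using card_Un_le[of A0 "A - A0"] by simp
    qed
    then have cA: "card A \<le> (c * n') * ((s-1)*(s-1)) + 2 * m * t * (t * n') + 2 * t * n"
      using A0 rest by (simp add: algebra_simps)
    obtain w where w: "s = Suc w" using s0 by (cases s) auto
    \<comment> \<open>Multiplying by \<open>s\<close> avoids division. The two error terms become
      exactly \<open>c * n\<close>, which dictates \<open>c\<close>; the recursive term is at most
      \<open>c * w * n\<close> by \<open>s * w \<le> t\<close>, and
      \<open>w + 1 = s\<close>.\<close>
    have "s * card A \<le> s * ((c * n') * (w*w) + 2 * m * t * n + 2 * t * n)"
    proof (intro mult_le_mono2 order_trans[OF cA] add_le_mono1 add_mono mult_le_mono2 tn)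
    qed (simp add: w)
    also have "\<dots> = (s * w) * (c * w * n') + c * n"
    proof -
      have "s * (2 * m * t * n + 2 * t * n) = c * n" unfolding c_def t_def by algebra
      then show ?thesis by algebra
    qed
    also have "\<dots> \<le> t * (c * w * n') + c * n"
      unfolding t_def power2_eq_square by (intro add_le_mono1 mult_le_mono1) (simp add: w)
    also have "\<dots> = c * w * (t * n') + c * n" by simp
    also have "\<dots> \<le> c * w * n + c * n" by (intro add_le_mono1 mult_le_mono2 tn)
    also have "\<dots> = s * (c * n)" by (simp add: w)
    finally show ?thesis using s0 by (simp add: c_def)
  qed
qed

subsection \<open>From matrices to ordered graphs\<close>

text \<open>
  The extra entry in the last row and the first column forces, in any copy inside a strictly upper
  triangular matrix, all rows of the copy of \<open>\<pi>\<close> to precede all its columns. Indices are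
  shifted to start at \<open>0\<close>.
\<close>

definition corner_extension :: "nat \<Rightarrow> (nat \<Rightarrow> nat) \<Rightarrow> nat \<Rightarrow> nat" where
  "corner_extension k \<pi> i = (if i < k then \<pi> (Suc i) else 0)"

lemma bij_betw_corner_extension:
  assumes "\<pi> permutes {1..k}"
  shows "bij_betw (corner_extension k \<pi>) {..<Suc k} {..<Suc k}"
proof -
  let ?\<sigma> = "corner_extension k \<pi>"
  have im: "\<pi> (Suc i) \<in> {1..k}" if "i < k" for i
    using permutes_in_image[OF assms, of "Suc i"] that by auto
  have "inj_on ?\<sigma> {..<Suc k}"
  proof (rule inj_onI)
    fix i j assume "i \<in> {..<Suc k}" "j \<in> {..<Suc k}" "?\<sigma> i = ?\<sigma> j"
    moreover have "i = j" if "\<pi> (Suc i) = \<pi> (Suc j)"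
      using injD[OF permutes_inj[OF assms] that] by simp
    ultimately show "i = j"
      using im[of i] im[of j] by (cases "i < k"; cases "j < k") (simp_all add: corner_extension_def)
  qed
  moreover have "?\<sigma> ` {..<Suc k} \<subseteq> {..<Suc k}"
    using im by (auto simp: corner_extension_def less_Suc_eq_le)
  ultimately show ?thesis
    using endo_inj_surj[OF finite_lessThan] unfolding bij_betw_def by blast
qed

text \<open>The extra entry adds at most one point to a window. Row indices drop by one, which
  moving the window absorbs; column indices stay, as \<open>0\<close> was free.\<close>

lemma scattered_corner_extension:
  assumes "\<And>a b. card {i\<in>{1..k}. i \<in> {a..<a+p} \<and> \<pi> i \<in> {b..<b+p}} \<le> r"
  shows "scattered p (Suc r) (Suc k) (corner_extension k \<pi>)"
  unfolding scattered_def
proof (intro allI)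
  fix a b
  let ?X = "{i\<in>{1..k}. i \<in> {Suc a..<Suc a+p} \<and> \<pi> i \<in> {b..<b+p}}"
  have "{i. i < Suc k \<and> i \<in> {a..<a+p} \<and> corner_extension k \<pi> i \<in> {b..<b+p}}
      \<subseteq> insert k ((\<lambda>i. i - 1) ` ?X)"
  proof
    fix i assume i: "i \<in> {i. i < Suc k \<and> i \<in> {a..<a+p} \<and> corner_extension k \<pi> i \<in> {b..<b+p}}"
    show "i \<in> insert k ((\<lambda>i. i - 1) ` ?X)"
    proof (cases "i = k")
      case False
      then have "Suc i \<in> ?X" using i by (auto simp: corner_extension_def)
      then show ?thesis by (intro insertI2 image_eqI[of _ _ "Suc i"]) simp_all
    qed simp
  qed
  then have "card {i. i < Suc k \<and> i \<in> {a..<a+p} \<and> corner_extension k \<pi> i \<in> {b..<b+p}}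
      \<le> card (insert k ((\<lambda>i. i - 1) ` ?X))" by (intro card_mono) auto
  also have "\<dots> \<le> Suc (card ?X)"
  proof -
    have "finite ?X" by simp
    then have "card ((\<lambda>i. i - 1) ` ?X) \<le> card ?X" by (rule card_image_le)
    moreover have "card (insert k I) \<le> Suc (card I)" for I
      by (cases "finite I") (simp_all add: card_insert_if)
    ultimately show ?thesis by (meson Suc_le_mono order_trans)
  qed
  also have "\<dots> \<le> Suc r" using assms[of "Suc a" b] by (simp only: Suc_le_mono)
  finally show "card {i. i < Suc k \<and> i \<in> {a..<a+p} \<and> corner_extension k \<pi> i \<in> {b..<b+p}} \<le> Suc r" .
qed

lemma contains_graph_if_contains_perm:
  assumes \<pi>: "\<pi> permutes {1..k}" and V: "strict_mono_on {..<n} h" "h ` {..<n} \<subseteq> V"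
    and A: "contains_perm (Suc k) (corner_extension k \<pi>) {(a, b). a < b \<and> b < n \<and> {h a, h b} \<in> E}"
  shows "contains_graph (V, E) (permutation_graph k \<pi>)"
proof -
  obtain f g where f: "strict_mono_on {..<Suc k} f" and g: "strict_mono_on {..<Suc k} g"
    and "\<forall>i<Suc k. (f i, g (corner_extension k \<pi> i)) \<in> {(a, b). a < b \<and> b < n \<and> {h a, h b} \<in> E}"
    using A unfolding contains_perm_def by blast
  then have fg: "\<forall>i<Suc k. f i < g (corner_extension k \<pi> i) \<and> g (corner_extension k \<pi> i) < n \<and>
      {h (f i), h (g (corner_extension k \<pi> i))} \<in> E"
    by simp
  have fn: "f i < n" if "i < Suc k" for i using fg[rule_format, OF that] by simp
  have gn: "g j < n" if "j < Suc k" for j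
  proof -
    have "j \<in> corner_extension k \<pi> ` {..<Suc k}"
      using bij_betw_corner_extension[OF \<pi>] that by (simp add: bij_betw_def)
    then obtain i where "i < Suc k" "corner_extension k \<pi> i = j" by blast
    then show ?thesis using fg[rule_format, of i] by simp
  qed
  have corner: "f k < g 0" using fg[rule_format, of k] by (simp add: corner_extension_def)
  \<comment> \<open>Row indices are lowered by one, column indices are not, since column
    \<open>0\<close> is the extra one. Row \<open>f k\<close> and column \<open>g 0\<close> separate
    the two halves.\<close>
  define F where "F v = (if v \<le> k then f (v - 1) else g (v - k))" for v
  have Fn: "F v < n" if "v \<in> {1..2*k}" for v using that fn gn by (auto simp: F_def)
  have mono: "strict_mono_on {1..2*k} F"
  proof (rule strict_mono_onI)
    fix v w assume vw: "v \<in> {1..2*k}" "w \<in> {1..2*k}" "v < w"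
    consider "w \<le> k" | "v \<le> k" "k < w" | "k < v" by linarith
    then show "F v < F w"
    proof cases
      case 1
      then have "f (v - 1) < f (w - 1)" using vw by (intro strict_mono_onD[OF f]) auto
      then show ?thesis using vw 1 by (simp add: F_def)
    next
      case 2
      have "f (v - 1) < f k" using vw 2 by (intro strict_mono_onD[OF f]) auto
      also note corner
      also have "g 0 < g (w - k)" using vw 2 by (intro strict_mono_onD[OF g]) auto
      finally show ?thesis using 2 by (simp add: F_def)
    next
      case 3
      then have "g (v - k) < g (w - k)" using vw by (intro strict_mono_onD[OF g]) auto
      then show ?thesis using vw 3 by (simp add: F_def)
    qed
  qed
  have hF: "strict_mono_on {1..2*k} (h \<circ> F)"
  proof (rule strict_mono_onI)
    fix v w assume vw: "v \<in> {1..2*k}" "w \<in> {1..2*k}" "v < w"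
    then have "F v < F w" by (rule strict_mono_onD[OF mono])
    then show "(h \<circ> F) v < (h \<circ> F) w"
      using strict_mono_onD[OF V(1), of "F v" "F w"] Fn vw by simp
  qed
  have edges: "e \<subseteq> {1..2*k} \<and> (h \<circ> F) ` e \<in> E" if e: "e \<in> snd (permutation_graph k \<pi>)" for e
  proof -
    obtain i where i: "i \<in> {1..k}" "e = {i, k + \<pi> i}"
      using e by (auto simp: permutation_graph_def)
    have "\<pi> i \<in> {1..k}" using permutes_in_image[OF \<pi>] i(1) by blast
    moreover have "{h (f (i - 1)), h (g (\<pi> i))} \<in> E"
    proof -
      have "i - 1 < k" "Suc (i - 1) = i" using i(1) by auto
      then show ?thesis using fg[rule_format, of "i - 1"] by (simp add: corner_extension_def)
    qed
    ultimately show ?thesis using i by (auto simp: F_def)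
  qed
  have "inj_on (\<lambda>e. (h \<circ> F) ` e) (snd (permutation_graph k \<pi>))"
  proof (rule inj_onI)
    fix e e' assume "e \<in> snd (permutation_graph k \<pi>)" "e' \<in> snd (permutation_graph k \<pi>)"
      "(h \<circ> F) ` e = (h \<circ> F) ` e'"
    then show "e = e'"
      using inj_on_image_eq_iff[OF strict_mono_on_imp_inj_on[OF hF]] edges by blast
  qed
  moreover have "(h \<circ> F) ` {1..2*k} \<subseteq> V" using Fn V(2) by (auto simp: image_subset_iff)
  ultimately show ?thesis
    unfolding contains_graph_def using hF edges
    by (intro exI[of _ "h \<circ> F"] exI[of _ "\<lambda>e. (h \<circ> F) ` e"]) (auto simp: permutation_graph_def)
qed

text \<open>Listing \<open>V\<close> in increasing order turns a host graph into a strictly upper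
  triangular matrix with one entry for each edge.\<close>

lemma gex_permutation_graph_le:
  assumes \<pi>: "\<pi> permutes {1..k}" and k: "k \<ge> 1" and s: "s \<ge> 2"
    and W: "row_unavoidable m s (Suc k) (corner_extension k \<pi>)"
      "row_unavoidable m s (Suc k) (inv_into {..<Suc k} (corner_extension k \<pi>))"
  shows "gex (permutation_graph k \<pi>) n \<le> 2 * (m + 1) * s ^ 3 * n"
  unfolding gex_def
proof (rule Max.boundedI[OF gex_set_finite gex_set_nonempty])
  \<comment> \<open>For \<open>k = 0\<close> every host would contain the empty pattern, and
    \<open>Max\<close> would be taken over the empty set.\<close>
  show "snd (permutation_graph k \<pi>) \<noteq> {}" using k by (auto simp: permutation_graph_def)
  fix c assume "c \<in> {card (snd G) |G :: nat graph. ordered_graph G \<and> finite (fst G) \<and>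
    card (fst G) = n \<and> avoids G (permutation_graph k \<pi>)}"
  then obtain V E where c: "c = card E" and G: "ordered_graph (V :: nat set, E)" "finite V" "card V = n"
    "avoids (V, E) (permutation_graph k \<pi>)" by auto
  obtain h where h: "bij_betw h {..<n} V" "strict_mono_on {..<n} h"
    using ex_bij_betw_strict_mono_card[OF G(2)] G(3) by auto
  define A where "A = {(a, b). a < b \<and> b < n \<and> {h a, h b} \<in> E}"
  have A_sub: "A \<subseteq> {..<n} \<times> {..<n}" by (auto simp: A_def)
  have "\<not> contains_perm (Suc k) (corner_extension k \<pi>) A"
    using contains_graph_if_contains_perm[OF \<pi> h(2), of V E] h(1) G(4)
    by (auto simp: A_def bij_betw_def)
  then have "card A \<le> 2 * (m + 1) * s ^ 3 * n"
    using marcus_tardos[OF bij_betw_corner_extension[OF \<pi>] s W A_sub] by blast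
  moreover have "card E \<le> card A"
  proof -
    have "E \<subseteq> (\<lambda>(a, b). {h a, h b}) ` A"
    proof
      fix e assume e: "e \<in> E"
      then have "card e = 2" "e \<subseteq> V" using G(1) by (auto simp: ordered_graph_def)
      then obtain x y where xy: "e = {x, y}" "x \<noteq> y" by (auto simp: card_2_iff)
      then obtain a b where ab: "a < n" "b < n" "x = h a" "y = h b"
        using \<open>e \<subseteq> V\<close> h(1) by (auto simp: bij_betw_def)
      then consider "a < b" | "b < a" using xy(2) by (metis linorder_neqE_nat)
      then show "e \<in> (\<lambda>(a, b). {h a, h b}) ` A"
      proof cases
        case 1
        then have "(a, b) \<in> A" using ab e xy by (simp add: A_def)
        then show ?thesis using ab xy by (intro image_eqI[of _ _ "(a, b)"]) simp_all
      next
        case 2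
        then have "(b, a) \<in> A" using ab e xy by (simp add: A_def insert_commute)
        then show ?thesis using ab xy by (intro image_eqI[of _ _ "(b, a)"]) (simp_all add: insert_commute)
      qed
    qed
    moreover have "finite A" using A_sub finite_subset by blast
    ultimately show ?thesis by (meson card_image_le card_mono finite_imageI order_trans)
  qed
  ultimately show "c \<le> 2 * (m + 1) * s ^ 3 * n" using c by simp
qed

lemma scattered_row_unavoidable:
  assumes "L > 0" "p > 0" "B > 0" "r > 0" "k \<le> B * p" "scattered p r k \<pi>"
    and "\<And>i. i < k \<Longrightarrow> \<pi> i < k" and s: "s = 4 * p * B" and "s \<le> D * (L - 1)"
    and T: "ln (real B) + 4 < real p / (real r * (2 * real L * ln (real s)))"
  shows "row_unavoidable (L ^ D) s k \<pi>"
  unfolding row_unavoidable_def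
proof (intro allI impI, elim conjE)
  fix S :: "nat \<Rightarrow> nat set" and C :: "nat set"
  assume C: "finite C" "card C = s\<^sup>2" and S: "\<forall>x<L ^ D. S x \<subseteq> C \<and> card (S x) = s"
  have "p * B \<ge> 1" using assms(2,3) by (simp add: Suc_le_eq)
  then have s4: "s \<ge> 4" using s by simp
  then have "s < s\<^sup>2" by (simp add: power2_eq_square)
  moreover have "real (s\<^sup>2) / real s = real s" using s4 by (simp add: power2_eq_square)
  ultimately show "contains_perm k \<pi> {(x, c). x < L ^ D \<and> c \<in> S x}"
    using assms C S by (intro dense_rows_contain_scattered[where C = C and t = "s\<^sup>2"]) auto
qed

subsection \<open>Random permutations are scattered\<close>

text \<open>There are at most \<open>card J ^ card T\<close> restrictions to \<open>T\<close>, and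
  two permutations with the same restriction differ by one that fixes \<open>T\<close>
  pointwise.\<close>

lemma card_permutes_mapping_into_le:
  fixes S T :: "'a set"
  assumes S: "finite S" and T: "T \<subseteq> S" and J: "finite J"
  shows "card {\<pi>. \<pi> permutes S \<and> \<pi> ` T \<subseteq> J} \<le> card J ^ card T * fact (card S - card T)"
proof -
  define X where "X = {\<pi>. \<pi> permutes S \<and> \<pi> ` T \<subseteq> J}"
  define R where "R = PiE T (\<lambda>_. J)"
  have fT: "finite T" using S T finite_subset by blast
  have fR: "finite R" unfolding R_def using fT J by (intro finite_PiE) auto
  have fX: "finite X" unfolding X_def using finite_permutations[OF S] by (rule finite_subset[rotated]) auto
  have fibre: "card {\<pi>\<in>X. restrict \<pi> T = \<phi>} \<le> fact (card S - card T)" for \<phi>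
  proof (cases "{\<pi>\<in>X. restrict \<pi> T = \<phi>} = {}")
    case False
    then obtain \<pi>0 where \<pi>0: "\<pi>0 permutes S" "restrict \<pi>0 T = \<phi>" by (auto simp: X_def)
    have "card {\<pi>\<in>X. restrict \<pi> T = \<phi>} \<le> card {\<sigma>. \<sigma> permutes (S - T)}"
    proof (rule card_inj_on_le[of "\<lambda>\<pi>. inv \<pi>0 \<circ> \<pi>"])
      show "inj_on (\<lambda>\<pi>. inv \<pi>0 \<circ> \<pi>) {\<pi>\<in>X. restrict \<pi> T = \<phi>}"
      proof (rule inj_onI)
        fix \<pi> \<pi>' assume "inv \<pi>0 \<circ> \<pi> = inv \<pi>0 \<circ> \<pi>'"
        then have "\<pi>0 \<circ> (inv \<pi>0 \<circ> \<pi>) = \<pi>0 \<circ> (inv \<pi>0 \<circ> \<pi>')" by simp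
        then show "\<pi> = \<pi>'" by (simp add: o_assoc permutes_inv_o[OF \<pi>0(1)])
      qed
      show "(\<lambda>\<pi>. inv \<pi>0 \<circ> \<pi>) ` {\<pi>\<in>X. restrict \<pi> T = \<phi>} \<subseteq> {\<sigma>. \<sigma> permutes (S - T)}"
      proof clarify
        fix \<pi> assume \<pi>: "\<pi> \<in> X" "\<phi> = restrict \<pi> T"
        have "inv \<pi>0 \<circ> \<pi> permutes S"
          using \<pi>(1) \<pi>0(1) by (auto simp: X_def intro: permutes_compose permutes_inv)
        moreover have "(inv \<pi>0 \<circ> \<pi>) x = x" if "x \<in> T" for x
        proof -
          have "\<pi> x = \<pi>0 x" using \<pi>(2) \<pi>0(2) that by (metis restrict_apply')
          then show ?thesis using permutes_inverses[OF \<pi>0(1)] by simp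
        qed
        ultimately show "inv \<pi>0 \<circ> \<pi> permutes (S - T)"
          by (rule permutes_superset) auto
      qed
    qed (use S in \<open>simp add: finite_permutations\<close>)
    also have "\<dots> = fact (card S - card T)"
      using S T fT by (simp add: card_permutations card_Diff_subset)
    finally show ?thesis .
  next
    case True
    show ?thesis unfolding True by simp
  qed
  have "card X = (\<Sum>\<phi>\<in>(\<lambda>\<pi>. restrict \<pi> T) ` X. card {\<pi>\<in>X. restrict \<pi> T = \<phi>})"
    using sum.image_gen[OF fX, of "\<lambda>_. 1::nat" "\<lambda>\<pi>. restrict \<pi> T"] by simp
  also have "\<dots> \<le> card ((\<lambda>\<pi>. restrict \<pi> T) ` X) * fact (card S - card T)"
    using sum_mono[of "(\<lambda>\<pi>. restrict \<pi> T) ` X", OF fibre] by simp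
  also have "\<dots> \<le> card R * fact (card S - card T)"
    using fR by (intro mult_le_mono1 card_mono) (auto simp: R_def X_def)
  also have "card R = card J ^ card T" unfolding R_def using fT by (simp add: card_PiE)
  finally show ?thesis by (simp add: X_def)
qed

lemma power_mult_fact_le: "n ^ r * fact n \<le> (fact (n + r) :: nat)"
proof (induction r)
  case (Suc r)
  have "n ^ Suc r * fact n = n * (n ^ r * fact n)" by simp
  also have "\<dots> \<le> (n + r + 1) * fact (n + r)" using Suc by (intro mult_le_mono) auto
  finally show ?case by simp
qed simp

definition crowded :: "nat \<Rightarrow> nat \<Rightarrow> nat \<Rightarrow> (nat \<Rightarrow> nat) \<Rightarrow> bool" where
  "crowded p r k \<pi> \<longleftrightarrow> (\<exists>a b. r \<le> card {i\<in>{1..k}. i \<in> {a..<a+p} \<and> \<pi> i \<in> {b..<b+p}})"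

text \<open>Union bound over the window corners and the sets \<open>T\<close> of \<open>r\<close>
  indices in the window that are mapped into its columns. As \<open>r \<ge> 1\<close>, a crowded
  window meets the matrix, so \<open>a\<close> and \<open>b\<close> are at most
  \<open>k\<close>.\<close>

lemma card_crowded_le:
  assumes r: "r \<ge> 1"
  shows "card {\<pi>. \<pi> permutes {1..k} \<and> crowded p r k \<pi>}
    \<le> (Suc k * Suc k) * (p ^ r * (p ^ r * fact (k - r)))"
proof -
  define M where "M a = {1..k} \<inter> {a..<a+p}" for a
  define Y where "Y b T = {\<pi>. \<pi> permutes {1..k} \<and> \<pi> ` T \<subseteq> {b..<b+p}}" for b T
  define \<T> where "\<T> a = {T. T \<subseteq> M a \<and> card T = r}" for a
  have fM: "finite (M a)" "card (M a) \<le> p" for a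
    using card_mono[of "{a..<a+p}" "M a"] by (auto simp: M_def)
  have f\<T>: "finite (\<T> a)" for a using fM by (simp add: \<T>_def)
  have c\<T>: "card (\<T> a) \<le> p ^ r" for a
  proof -
    have "card (\<T> a) = card (M a) choose r" unfolding \<T>_def by (rule n_subsets[OF fM(1)])
    also have "\<dots> \<le> card (M a) ^ r"
      by (cases "r \<le> card (M a)") (auto intro: binomial_le_pow simp: binomial_eq_0)
    also have "\<dots> \<le> p ^ r" using fM(2) by (intro power_mono) auto
    finally show ?thesis .
  qed
  have cY: "card (Y b T) \<le> p ^ r * fact (k - r)" if "T \<in> \<T> a" for a b T
    using card_permutes_mapping_into_le[of "{1..k}" T "{b..<b+p}"] that
    by (auto simp: \<T>_def M_def Y_def)
  have fY: "finite (Y b T)" for b T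
    by (rule finite_subset[OF _ finite_permutations[of "{1..k}"]]) (auto simp: Y_def)
  have "{\<pi>. \<pi> permutes {1..k} \<and> crowded p r k \<pi>}
      \<subseteq> (\<Union>(a, b)\<in>{..k} \<times> {..k}. \<Union>T\<in>\<T> a. Y b T)"
  proof clarify
    fix \<pi> assume \<pi>: "\<pi> permutes {1..k}" "crowded p r k \<pi>"
    then obtain a b where ab: "r \<le> card {i\<in>{1..k}. i \<in> {a..<a+p} \<and> \<pi> i \<in> {b..<b+p}}"
      by (auto simp: crowded_def)
    then obtain T where T: "T \<subseteq> {i\<in>{1..k}. i \<in> {a..<a+p} \<and> \<pi> i \<in> {b..<b+p}}" "card T = r"
      by (rule obtain_subset_with_card_n)
    then obtain i where "i \<in> T" using r by fastforce
    then have i: "i \<in> {1..k}" "a \<le> i" "b \<le> \<pi> i" using T by auto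
    have "\<pi> i \<in> {1..k}" using permutes_in_image[OF \<pi>(1)] i(1) by blast
    then have "a \<le> k" "b \<le> k" using i by auto
    moreover have "T \<in> \<T> a" "\<pi> \<in> Y b T" using T \<pi> by (auto simp: \<T>_def M_def Y_def)
    ultimately show "\<pi> \<in> (\<Union>(a, b)\<in>{..k} \<times> {..k}. \<Union>T\<in>\<T> a. Y b T)" by blast
  qed
  then have "card {\<pi>. \<pi> permutes {1..k} \<and> crowded p r k \<pi>}
      \<le> card (\<Union>(a, b)\<in>{..k} \<times> {..k}. \<Union>T\<in>\<T> a. Y b T)"
    using f\<T> fY by (intro card_mono) auto
  also have "\<dots> \<le> (\<Sum>q\<in>{..k} \<times> {..k}. card (case q of (a, b) \<Rightarrow> \<Union>T\<in>\<T> a. Y b T))"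
    by (intro card_UN_le) auto
  also have "\<dots> \<le> (\<Sum>q\<in>{..k} \<times> {..k}. p ^ r * (p ^ r * fact (k - r)))"
  proof (intro sum_mono, clarify)
    fix a b
    have "card (\<Union>T\<in>\<T> a. Y b T) \<le> (\<Sum>T\<in>\<T> a. card (Y b T))" using f\<T> by (rule card_UN_le)
    also have "\<dots> \<le> (\<Sum>T\<in>\<T> a. p ^ r * fact (k - r))" using cY by (intro sum_mono)
    also have "\<dots> \<le> p ^ r * (p ^ r * fact (k - r))" using c\<T> by simp
    finally show "card (\<Union>T\<in>\<T> a. Y b T) \<le> p ^ r * (p ^ r * fact (k - r))" .
  qed
  also have "\<dots> = (Suc k * Suc k) * (p ^ r * (p ^ r * fact (k - r)))"
    by (simp add: card_cartesian_product)
  finally show ?thesis .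
qed

lemma crowded_fraction_le:
  assumes "r \<ge> 1" "r < k"
  shows "card {\<pi>. \<pi> permutes {1..k} \<and> crowded p r k \<pi>} / fact k
    \<le> (real k + 1)\<^sup>2 * (real p ^ 2 / (real k - real r)) ^ r"
proof -
  have "real ((k - r) ^ r * fact (k - r)) \<le> real (fact k)"
    using power_mult_fact_le[of "k - r" r] assms by (simp only: of_nat_le_iff) simp
  then have f: "(real k - r) ^ r * fact (k - r) \<le> fact k"
    using assms by (simp add: of_nat_diff)
  have pos: "(real k - r) ^ r > 0" using assms by simp
  have "real (card {\<pi>. \<pi> permutes {1..k} \<and> crowded p r k \<pi>})
      \<le> real ((Suc k * Suc k) * (p ^ r * (p ^ r * fact (k - r))))"
    using card_crowded_le[OF assms(1)] by (simp only: of_nat_le_iff)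
  also have "\<dots> = (real k + 1)\<^sup>2 * (real p ^ 2) ^ r * fact (k - r)"
    by (simp add: power2_eq_square power_mult_distrib algebra_simps)
  also have "\<dots> \<le> (real k + 1)\<^sup>2 * (real p ^ 2) ^ r * (fact k / (real k - r) ^ r)"
    using f pos by (intro mult_left_mono) (auto simp: field_simps)
  finally show ?thesis by (simp add: power_divide field_simps)
qed

subsection \<open>Choice of the parameters\<close>

text \<open>The pattern has length \<open>Suc k\<close>, and \<open>B\<close> satisfies
  \<open>Suc k \<le> B * p\<close>; depth \<open>s div (L - 1) + 1\<close> provides at least
  \<open>s\<close> cells off each path. The recursion also needs the inverse pattern, which is
  equally scattered.\<close>

lemma gex_le_if_not_crowded:
  fixes k p L r :: nat
  assumes \<pi>: "\<pi> permutes {1..k}" and nc: "\<not> crowded p r k \<pi>" and k: "k \<ge> 1" and r: "r \<ge> 1"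
    and p: "p > 0" and L: "L \<ge> 2"
  defines "B \<equiv> Suc k div p + 1" and "s \<equiv> 4 * p * (Suc k div p + 1)"
  assumes T: "ln (real B) + 4 < real p / (real r * (2 * real L * ln (real s)))"
  shows "gex (permutation_graph k \<pi>) n \<le> 2 * (L ^ (s div (L - 1) + 1) + 1) * s ^ 3 * n"
proof -
  let ?\<sigma> = "corner_extension k \<pi>"
  let ?\<tau> = "inv_into {..<Suc k} ?\<sigma>"
  have \<sigma>: "bij_betw ?\<sigma> {..<Suc k} {..<Suc k}" by (rule bij_betw_corner_extension[OF \<pi>])
  have \<tau>: "bij_betw ?\<tau> {..<Suc k} {..<Suc k}" using \<sigma> by (rule bij_betw_inv_into)
  \<comment> \<open>At most \<open>r - 1\<close> points here leave room for the corner
    entry.\<close>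
  have "card {i\<in>{1..k}. i \<in> {a..<a+p} \<and> \<pi> i \<in> {b..<b+p}} \<le> r - 1" for a b
  proof -
    have "\<not> r \<le> card {i\<in>{1..k}. i \<in> {a..<a+p} \<and> \<pi> i \<in> {b..<b+p}}"
      using nc unfolding crowded_def by blast
    then show ?thesis by linarith
  qed
  from scattered_corner_extension[of k p \<pi> "r - 1", OF this]
  have sc: "scattered p r (Suc k) ?\<sigma>" using r by simp
  have Bp: "Suc k \<le> B * p"
    using dividend_less_div_times[OF p, of "Suc k"] by (simp add: B_def)
  have B: "B > 0" by (simp add: B_def)
  have s: "s = 4 * p * B" by (simp add: s_def B_def)
  have "p * B \<ge> 1" using p B by (simp add: Suc_le_eq)
  then have s2: "s \<ge> 2" using s by simp
  have D: "s \<le> (s div (L - 1) + 1) * (L - 1)"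
    using dividend_less_div_times[of "L - 1" s] L by simp
  have un: "row_unavoidable (L ^ (s div (L - 1) + 1)) s (Suc k) \<rho>"
    if "scattered p r (Suc k) \<rho>" "bij_betw \<rho> {..<Suc k} {..<Suc k}" for \<rho>
  proof (rule scattered_row_unavoidable[OF _ p B _ Bp that(1) _ s D T])
    show "\<rho> i < Suc k" if "i < Suc k" for i
      using \<open>bij_betw \<rho> _ _\<close> that by (auto simp: bij_betw_def)
  qed (use L r in auto)
  show ?thesis
    by (rule gex_permutation_graph_le[OF \<pi> k s2 un[OF sc \<sigma>] un[OF scattered_inverse[OF \<sigma> sc] \<tau>]])
qed

text \<open>
  A window with side \<open>k powr (7/16)\<close> is expected to contain about \<open>k powr (- 1/8)\<close> points, so
  the probability that one of the \<open>k\<^sup>2\<close> windows has \<open>20\<close> points is about \<open>k powr (2 - 20/8)\<close>.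
\<close>

definition window :: "nat \<Rightarrow> nat" where
  "window k = nat \<lceil>real k powr (7/16)\<rceil>"

lemma eventually_gex_le:
  "\<forall>\<^sub>F k in at_top. \<forall>\<pi> n. \<pi> permutes {1..k} \<longrightarrow> \<not> crowded (window k) 20 k \<pi> \<longrightarrow>
     real (gex (permutation_graph k \<pi>) n) \<le> 2 powr (real k powr (2/3)) * real n"
proof -
  \<comment> \<open>This yields the hypothesis \<open>T\<close> with \<open>20\<close> for
    \<open>r\<close>: \<open>80\<close> is \<open>20 * 2 * 2\<close> because rounding at most
    doubles \<open>L\<close>, and \<open>s \<le> 12 * k\<close>. It holds as
    \<open>7/16 > 3/8\<close>.\<close>
  have "\<forall>\<^sub>F k::nat in at_top. ln (real k) + 4 < real k powr (7/16) / (80 * real k powr (3/8) * ln (12 * real k))"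
    by real_asymp
  \<comment> \<open>The left side bounds the logarithm of \<open>4 * L ^ D * s ^ 3\<close>; its main
    term is of order \<open>k powr (5/8)\<close> times a logarithm, and
    \<open>5/8 < 2/3\<close>.\<close>
  moreover have "\<forall>\<^sub>F k::nat in at_top. ln 4 + (12 * real k / (real k powr (3/8) - 1) + 1) * ln (2 * real k powr (3/8))
      + 3 * ln (12 * real k) \<le> ln 2 * (real k powr (2/3))"
    by real_asymp
  moreover have "\<forall>\<^sub>F k::nat in at_top. 2 * real k powr (7/16) \<le> real k \<and> real k powr (3/8) \<ge> 2 \<and> real k powr (7/16) \<ge> 3"
    by (intro eventually_conj; real_asymp)
  ultimately show ?thesis
  proof eventually_elim
    case (elim k)
    define P where "P = real k powr (7/16)"
    define \<Lambda> where "\<Lambda> = real k powr (3/8)"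
    define p where "p = window k"
    define L where "L = nat \<lceil>\<Lambda>\<rceil>"
    define B where "B = Suc k div p + 1"
    define s where "s = 4 * p * B"
    define D where "D = s div (L - 1) + 1"
    have e: "ln (real k) + 4 < P / (80 * \<Lambda> * ln (12 * real k))"
      "ln 4 + (12 * real k / (\<Lambda> - 1) + 1) * ln (2 * \<Lambda>) + 3 * ln (12 * real k) \<le> ln 2 * (real k powr (2/3))"
      "2 * P \<le> real k" "\<Lambda> \<ge> 2" "P \<ge> 3"
      using elim by (simp_all add: P_def \<Lambda>_def)
    have p: "P \<le> real p" "real p \<le> 2 * P"
      using e(5) unfolding p_def window_def P_def by linarith+
    have L: "\<Lambda> \<le> real L" "real L \<le> 2 * \<Lambda>" "L \<ge> 2"
      using e(4) unfolding L_def by linarith+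
    have k6: "real k \<ge> 6" using e by linarith
    have p3: "p \<ge> 3" using p(1) e(5) by linarith
    have pB: "p * B \<le> 3 * k"
    proof -
      have "p * B = p * (Suc k div p) + p" by (simp add: B_def)
      also have "\<dots> \<le> Suc k + p" by simp
      also have "\<dots> \<le> 3 * k" using p(2) e(3) k6 by linarith
      finally show ?thesis .
    qed
    have B0: "B > 0" by (simp add: B_def)
    have Bk: "B \<le> k"
    proof -
      have "3 * B \<le> p * B" using p3 by (rule mult_le_mono1)
      then show ?thesis using pB by linarith
    qed
    have "p * B \<ge> 1" using p3 B0 by (simp add: Suc_le_eq)
    moreover have "s = 4 * (p * B)" by (simp add: s_def)
    ultimately have s: "4 \<le> s" "s \<le> 12 * k" using pB by linarith+
    have lns: "0 < ln (real s)" "ln (real s) \<le> ln (12 * real k)"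
    proof -
      have "real s \<ge> 4" "real s \<le> 12 * real k" using s by linarith+
      then show "0 < ln (real s)" "ln (real s) \<le> ln (12 * real k)" by simp_all
    qed
    have "ln (real B) + 4 \<le> ln (real k) + 4" using Bk B0 by simp
    also note e(1)
    also have "P / (80 * \<Lambda> * ln (12 * real k)) \<le> real p / (real 20 * (2 * real L * ln (real s)))"
    proof (rule frac_le)
      have "real L * ln (real s) \<le> (2 * \<Lambda>) * ln (12 * real k)"
        using L e(4) lns by (intro mult_mono) auto
      then show "real 20 * (2 * real L * ln (real s)) \<le> 80 * \<Lambda> * ln (12 * real k)" by simp
      show "0 < real 20 * (2 * real L * ln (real s))" using L(3) lns(1) by simp
    qed (use p in auto)
    finally have T: "ln (real B) + 4 < real p / (real 20 * (2 * real L * ln (real s)))" .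
    have D: "real D \<le> 12 * real k / (\<Lambda> - 1) + 1"
    proof -
      have "real (s div (L - 1)) \<le> real s / real (L - 1)" by (rule of_nat_div_le_of_nat)
      also have "\<dots> \<le> 12 * real k / (\<Lambda> - 1)"
      proof (rule frac_le)
        show "real s \<le> 12 * real k" using s(2) by linarith
        show "\<Lambda> - 1 \<le> real (L - 1)" using L by linarith
      qed (use e(4) in auto)
      finally show ?thesis by (simp add: D_def)
    qed
    have bound: "real (2 * (L ^ D + 1) * s ^ 3) \<le> 2 powr (real k powr (2/3))"
    proof -
      have pos: "real L > 0" "real s > 0" using L(3) s(1) by auto
      have "L ^ D \<ge> 1" using L(3) by simp
      then have "2 * (L ^ D + 1) * s ^ 3 \<le> 4 * L ^ D * s ^ 3" by (intro mult_le_mono1) simp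
      then have "real (2 * (L ^ D + 1) * s ^ 3) \<le> real (4 * L ^ D * s ^ 3)" by (simp only: of_nat_le_iff)
      also have "\<dots> = exp (ln (4 * real L ^ D * real s ^ 3))" using pos by simp
      also have "ln (4 * real L ^ D * real s ^ 3) = ln 4 + real D * ln (real L) + 3 * ln (real s)"
        using pos by (simp add: ln_mult_pos ln_realpow)
      also have "\<dots> \<le> ln 4 + (12 * real k / (\<Lambda> - 1) + 1) * ln (2 * \<Lambda>) + 3 * ln (12 * real k)"
      proof (intro add_mono mult_mono mult_left_mono)
        show "ln (real L) \<le> ln (2 * \<Lambda>)" using L pos by simp
        show "0 \<le> ln (real L)" using L(3) by simp
        show "0 \<le> 12 * real k / (\<Lambda> - 1) + 1" using e(4) by simp
      qed (use D lns in auto)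
      also note e(2)
      finally show ?thesis by (simp add: powr_def mult.commute)
    qed
    show ?case
    proof (intro allI impI)
      fix \<pi> n assume \<pi>: "\<pi> permutes {1..k}" "\<not> crowded (window k) 20 k \<pi>"
      have "gex (permutation_graph k \<pi>) n \<le> 2 * (L ^ D + 1) * s ^ 3 * n"
        unfolding D_def s_def B_def
      proof (rule gex_le_if_not_crowded[OF \<pi>(1) \<pi>(2)[folded p_def] _ _ _ L(3) T[unfolded s_def B_def]])
      qed (use k6 p3 in auto)
      then have "real (gex (permutation_graph k \<pi>) n) \<le> real (2 * (L ^ D + 1) * s ^ 3) * real n"
        by (simp only: of_nat_le_iff flip: of_nat_mult)
      also have "\<dots> \<le> 2 powr (real k powr (2/3)) * real n"
        using bound by (rule mult_right_mono) simp
      finally show "real (gex (permutation_graph k \<pi>) n) \<le> 2 powr (real k powr (2/3)) * real n" .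
    qed
  qed
qed

lemma crowded_fraction_tendsto_0:
  "(\<lambda>k. real (card {\<pi>. \<pi> permutes {1..k} \<and> crowded (window k) 20 k \<pi>}) / fact k) \<longlonglongrightarrow> 0"
proof (rule tendsto_sandwich[OF _ _ tendsto_const])
  \<comment> \<open>The exponent of \<open>k\<close> is \<open>2 + 20 * (7/8 - 1)\<close>, that is
    \<open>- 1/2\<close>.\<close>
  show "(\<lambda>k::nat. (real k + 1)\<^sup>2 * ((2 * real k powr (7/16))\<^sup>2 / (real k - 20)) ^ 20) \<longlonglongrightarrow> 0"
    by real_asymp
  show "\<forall>\<^sub>F k in at_top. real (card {\<pi>. \<pi> permutes {1..k} \<and> crowded (window k) 20 k \<pi>}) / fact k
      \<le> (real k + 1)\<^sup>2 * ((2 * real k powr (7/16))\<^sup>2 / (real k - 20)) ^ 20"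
    using eventually_gt_at_top[of 20]
  proof eventually_elim
    case (elim k)
    have "real k powr (7/16) \<ge> 1" using elim by (simp add: ge_one_powr_ge_zero)
    then have p: "real (window k) \<le> 2 * real k powr (7/16)" unfolding window_def by linarith
    have "real (card {\<pi>. \<pi> permutes {1..k} \<and> crowded (window k) 20 k \<pi>}) / fact k
        \<le> (real k + 1)\<^sup>2 * (real (window k) ^ 2 / (real k - real 20)) ^ 20"
      using elim by (intro crowded_fraction_le) auto
    also have "\<dots> \<le> (real k + 1)\<^sup>2 * ((2 * real k powr (7/16))\<^sup>2 / (real k - 20)) ^ 20"
    proof -
      have "real (window k) ^ 2 \<le> (2 * real k powr (7/16))\<^sup>2" using p by (intro power_mono) auto
      then have "real (window k) ^ 2 / (real k - 20) \<le> (2 * real k powr (7/16))\<^sup>2 / (real k - 20)"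
        using elim by (intro divide_right_mono) auto
      moreover have "0 \<le> real (window k) ^ 2 / (real k - real 20)" using elim by simp
      ultimately show ?thesis by (intro mult_left_mono power_mono) simp_all
    qed
    finally show ?case .
  qed
qed simp

theorem corollary2p5:
  shows "\<exists>C::real. C > 0 \<and>
    (\<lambda>k. real (card {Q \<in> permutation_graphs k.
              \<forall>n\<ge>1. real (gex Q n) \<le>
                2 powr (C * real k powr (2/3) * log 2 (real k) powr (7/3)
                          / log 2 (log 2 (real k)) powr (1/3)) * real n})
          / real (card (permutation_graphs k)))
    \<longlonglongrightarrow> 1"
proof (intro exI[of _ 1] conjI)
  define X where "X k = 1 * real k powr (2/3) * log 2 (real k) powr (7/3)
                          / log 2 (log 2 (real k)) powr (1/3)" for k :: nat
  define good where "good k = {Q \<in> permutation_graphs k. \<forall>n\<ge>1. real (gex Q n) \<le> 2 powr X k * real n}" for k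
  define bad where "bad k = {\<pi>. \<pi> permutes {1..k} \<and> crowded (window k) 20 k \<pi>}" for k
  have fin: "finite (permutation_graphs k)" for k
    using card_permutation_graphs[of k] by (intro card_ge_0_finite) simp
  \<comment> \<open>The bound \<open>2 powr (k powr (2/3))\<close> is stronger than the claim, whose
    logarithmic factor is eventually at least \<open>1\<close>; hence the constant \<open>1\<close>
    suffices.\<close>
  have "\<forall>\<^sub>F k::nat in at_top. 1 \<le> log 2 (real k) powr (7/3) / log 2 (log 2 (real k)) powr (1/3)"
    by real_asymp
  with eventually_gex_le
  have low: "\<forall>\<^sub>F k in at_top. 1 - real (card (bad k)) / fact k \<le> real (card (good k)) / real (card (permutation_graphs k))"
  proof eventually_elim
    case (elim k)
    have "real k powr (2/3) * 1 \<le> real k powr (2/3) * (log 2 (real k) powr (7/3) / log 2 (log 2 (real k)) powr (1/3))"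
      using elim(2) by (intro mult_left_mono) auto
    then have X: "real k powr (2/3) \<le> X k" by (simp add: X_def)
    have "permutation_graph k \<pi> \<in> good k" if "\<pi> permutes {1..k}" "\<pi> \<notin> bad k" for \<pi>
    proof -
      have "real (gex (permutation_graph k \<pi>) n) \<le> 2 powr X k * real n" for n
      proof -
        have "real (gex (permutation_graph k \<pi>) n) \<le> 2 powr (real k powr (2/3)) * real n"
          using elim(1) that by (auto simp: bad_def)
        also have "\<dots> \<le> 2 powr X k * real n" using X by (intro mult_right_mono) auto
        finally show ?thesis .
      qed
      then show ?thesis using that(1) by (auto simp: good_def permutation_graphs_def)
    qed
    \<comment> \<open>Every graph outside \<open>good k\<close> comes from a bad permutation, so
      there are at most \<open>card (bad k)\<close> of them.\<close>
    then have "permutation_graphs k \<subseteq> good k \<union> permutation_graph k ` bad k"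
      unfolding permutation_graphs_def by blast
    moreover have fb: "finite (bad k)"
      by (rule finite_subset[OF _ finite_permutations[of "{1..k}"]]) (auto simp: bad_def)
    moreover have "finite (good k)" using fin by (simp add: good_def)
    ultimately have "card (permutation_graphs k) \<le> card (good k \<union> permutation_graph k ` bad k)"
      by (intro card_mono) auto
    also have "\<dots> \<le> card (good k) + card (permutation_graph k ` bad k)" by (rule card_Un_le)
    also have "\<dots> \<le> card (good k) + card (bad k)" using fb by (intro add_left_mono card_image_le)
    finally have "fact k \<le> real (card (good k)) + real (card (bad k))"
      unfolding card_permutation_graphs by (metis of_nat_add of_nat_fact of_nat_le_iff)
    then have "(fact k - real (card (bad k))) / fact k \<le> real (card (good k)) / fact k"
      by (intro divide_right_mono) auto
    then show ?case by (simp add: card_permutation_graphs diff_divide_distrib)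
  qed
  have high: "real (card (good k)) / real (card (permutation_graphs k)) \<le> 1" for k
  proof -
    have "card (good k) \<le> card (permutation_graphs k)"
      using fin by (intro card_mono) (auto simp: good_def)
    then have "real (card (good k)) \<le> real (card (permutation_graphs k))" by simp
    moreover have "real (card (permutation_graphs k)) > 0" by (simp add: card_permutation_graphs)
    ultimately show ?thesis by (simp only: divide_le_eq_1_pos)
  qed
  have "(\<lambda>k. 1 - real (card (bad k)) / fact k) \<longlonglongrightarrow> 1"
    using tendsto_diff[OF tendsto_const[of "1::real"] crowded_fraction_tendsto_0] by (simp add: bad_def)
  then have "(\<lambda>k. real (card (good k)) / real (card (permutation_graphs k))) \<longlonglongrightarrow> 1"
    by (rule tendsto_sandwich[OF low always_eventually[OF allI[OF high]] _ tendsto_const])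
  then show "(\<lambda>k. real (card {Q \<in> permutation_graphs k.
              \<forall>n\<ge>1. real (gex Q n) \<le>
                2 powr (1 * real k powr (2/3) * log 2 (real k) powr (7/3)
                          / log 2 (log 2 (real k)) powr (1/3)) * real n})
          / real (card (permutation_graphs k))) \<longlonglongrightarrow> 1"
    unfolding good_def X_def .
qed simp

end
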